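(* Assume all hypotheses on $N,\psi,A_F,A_{\tilde F},G_\pm$ stated in the context. Let $\chi^*$ be a primitive Dirichlet character modulo $c^*$ with $(c^*,N)=1$. For positive integers $q,m$ coprime to $N$ define, for $\mathrm{Re}\,s\gg1$, $$\mathbf H(q,m,\chi^*,s)=\sum_{d_2\mid q}\sum_{d_1\ell=m}\frac{\psi(d_2)\chi^*(d_1d_2)}{d_2^s}H\Big(\frac{qd_1}{d_2},\ell,\chi^*,s\Big),$$ and for $\mathrm{Re}(1-s)\gg1$, $$\mathbf G(q,m,\chi^*,s)=\sum_{d_2\mid q}\sum_{d_1\ell=m}\frac{\psi(d_2)\chi^*(d_1d_2)}{d_2^s}G\Big(\frac{qd_1}{d_2},\ell,\chi^*,s\Big).$$ Then both $\mathbf H(q,m,\chi^*,s)$ and $\mathbf G(q,m,\chi^*,s)$ have analytic continuation to all $s\in\mathbb C$, and $\mathbf H(q,m,\chi^*,s)=\mathbf G(q,m,\chi^*,s)$.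
   Context: Hypotheses: $N\ge1$, $\psi$ a Dirichlet character mod $N$; $A_F(m_1,m_2)$, $A_{\tilde F}(m_1,m_2)$ complex numbers indexed by positive integers with $A_F(m,n)=\psi(m)\psi(n)A_{\tilde F}(n,m)$ whenever $(mn,N)=1$, satisfying for all positive $m,n_1,n_2$ with $(n_1n_2,N)=1$: $A_F(1,m)A_F(n_2,n_1)=\sum_{abc=m,\,b\mid n_1,\,c\mid n_2}A_F(\frac{bn_2}c,\frac{an_1}b)\psi(c)$ and $A_{\tilde F}(1,m)A_{\tilde F}(n_2,n_1)=\sum_{abc=m,\,b\mid n_1,\,c\mid n_2}A_{\tilde F}(\frac{bn_2}c,\frac{an_1}b)\bar\psi(c)$. $G_+,G_-$ are functions of $s$ such that for every primitive Dirichlet character $\chi^*$ mod $c^*$ with $(c^*,N)=1$: $L(s,F\times\chi^* )=G_\pm(s)\psi(c^* )\chi^*(N)(c^* )^{-3s}\tau(\chi^* )^3L(1-s,\tilde F\times\overline{\chi^*})$, where $L(s,F\times\chi^* )=\sum_{n\ge1}A_F(1,n)\chi^*(n)n^{-s}$, $L(s,\tilde F\times\overline{\chi^*})=\sum_{n\ge1}A_{\tilde F}(1,n)\overline{\chi^*}(n)n^{-s}$, $\tau(\chi^* )=\sum_{u\bmod c^*}\chi^*(u)e(u/c^* )$, and $G_\pm$ means $G_+$ if $\chi^*(-1)=1$ and $G_-$ if $\chi^*(-1)=-1$. Notation: $e(x)=\exp(2\pi ix)$; for an integer $C$ divisible by $c^*$, $g(\chi^*,C,n)=\sum_{1\le u\le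 C,(u,C)=1}e(un/C)\chi^*(u)$. For positive integers $q$ (coprime to $N$) and $\ell$, put $c=\ell c^*$ and define $$H(q,\ell,\chi^*,s)=\sum_{n\ge1}\frac{A_F(q,n)\,g(\overline{\chi^*},c,n)}{n^s\,\ell^{1-2s}},$$ $$G(q,\ell,\chi^*,s)=\frac{\chi^*(-N)\psi(qc)G_\pm(s)}{c^{3s-1}\ell^{1-2s}}\sum_{d:\ dc^*\mid qc}\ \sum_{n\ge1}\frac{A_{\tilde F}(d,n)}{dn}\Big(\frac{d^2n}{q}\Big)^s g(\chi^*,c,d)\,g\Big(\chi^*,\frac{qc}{d},n\Big).$$ Sums $\sum_{d_2\mid q}$ and $\sum_{d_1\ell=m}$ run over positive integers. *)

theory Defs
  imports "HOL-Complex_Analysis.Complex_Analysis"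
begin

section \<open>Dirichlet characters\<close>

text \<open>Characters are functions on all integers, so that values such as \<open>chi(-1)\<close> make sense.\<close>

definition dirichlet_character :: "nat \<Rightarrow> (int \<Rightarrow> complex) \<Rightarrow> bool" where
  "dirichlet_character k chi \<longleftrightarrow> k > 0 \<and>
     (\<forall>a b. chi (a * b) = chi a * chi b) \<and>
     (\<forall>a. chi (a + int k) = chi a) \<and>
     (\<forall>a. chi a \<noteq> 0 \<longleftrightarrow> coprime a (int k))"

definition induced_modulus :: "nat \<Rightarrow> (int \<Rightarrow> complex) \<Rightarrow> nat \<Rightarrow> bool" where
  "induced_modulus k chi d \<longleftrightarrow> d dvd k \<and>
     (\<forall>a. coprime a (int k) \<and> a mod int d = 1 mod int d \<longrightarrow> chi a = 1)"

definition primitive_character :: "nat \<Rightarrow> (int \<Rightarrow> complex) \<Rightarrow> bool" where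
  "primitive_character k chi \<longleftrightarrow> dirichlet_character k chi \<and>
     (\<forall>d. induced_modulus k chi d \<longrightarrow> d = k)"

definition conj_char :: "(int \<Rightarrow> complex) \<Rightarrow> int \<Rightarrow> complex" where
  "conj_char chi a = cnj (chi a)"

definition e_unit :: "real \<Rightarrow> complex" where
  "e_unit x = exp (2 * complex_of_real pi * \<i> * complex_of_real x)"

definition gauss_sum :: "nat \<Rightarrow> (int \<Rightarrow> complex) \<Rightarrow> complex" where
  "gauss_sum k chi = (\<Sum>u<k. chi (int u) * e_unit (real u / real k))"

definition g_sum :: "(int \<Rightarrow> complex) \<Rightarrow> nat \<Rightarrow> nat \<Rightarrow> complex" where
  "g_sum chi C n = (\<Sum>u | 1 \<le> u \<and> u \<le> C \<and> coprime u C. e_unit (real u * real n / real C) * chi (int u))"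

section \<open>Dirichlet series with entire continuation\<close>

text \<open>\<open>has_sum\<close> is absolute convergence here.  Since the half-plane is not specified, this is
  the same as ordinary convergence of the series in some right half-plane.\<close>

definition entire_L_function :: "(nat \<Rightarrow> complex) \<Rightarrow> (complex \<Rightarrow> complex) \<Rightarrow> bool" where
  "entire_L_function a L \<longleftrightarrow> L holomorphic_on UNIV \<and>
     (\<exists>\<sigma>::real. \<forall>s. Re s > \<sigma> \<longrightarrow> ((\<lambda>n. a n * of_nat n powr (- s)) has_sum L s) {1..})"

definition by_parity :: "(int \<Rightarrow> complex) \<Rightarrow> 'a \<Rightarrow> 'a \<Rightarrow> 'a" where
  "by_parity chi x_plus x_minus = (if chi (- 1) = 1 then x_plus else x_minus)"

section \<open>The series H and G\<close>

text \<open>The modulus \<open>k\<close> of the character \<open>chi\<close> is passed separately, and \<open>c = l * k\<close> below.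
  An infinite sum that does not converge has the value 0 in HOL, so convergence of the
  series is recorded by the separate predicates \<open>H_converges\<close> and \<open>G_converges\<close>.\<close>

definition H_term :: "(nat \<Rightarrow> nat \<Rightarrow> complex) \<Rightarrow> nat \<Rightarrow> (int \<Rightarrow> complex) \<Rightarrow> nat \<Rightarrow> nat \<Rightarrow>
    complex \<Rightarrow> nat \<Rightarrow> complex" where
  "H_term A k chi q l s n =
     A q n * g_sum (conj_char chi) (l * k) n / (of_nat n powr s * of_nat l powr (1 - 2 * s))"

definition H_series :: "(nat \<Rightarrow> nat \<Rightarrow> complex) \<Rightarrow> nat \<Rightarrow> (int \<Rightarrow> complex) \<Rightarrow> nat \<Rightarrow> nat \<Rightarrow>
    complex \<Rightarrow> complex" where
  "H_series A k chi q l s = (\<Sum>\<^sub>\<infinity>n\<in>{1..}. H_term A k chi q l s n)"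

definition H_converges :: "(nat \<Rightarrow> nat \<Rightarrow> complex) \<Rightarrow> nat \<Rightarrow> (int \<Rightarrow> complex) \<Rightarrow> nat \<Rightarrow> nat \<Rightarrow>
    complex \<Rightarrow> bool" where
  "H_converges A k chi q l s \<longleftrightarrow> H_term A k chi q l s summable_on {1..}"

definition G_term :: "(nat \<Rightarrow> nat \<Rightarrow> complex) \<Rightarrow> nat \<Rightarrow> (int \<Rightarrow> complex) \<Rightarrow> nat \<Rightarrow> nat \<Rightarrow>
    complex \<Rightarrow> nat \<Rightarrow> nat \<Rightarrow> complex" where
  "G_term At k chi q l s d n =
     At d n / of_nat (d * n) * (of_nat (d\<^sup>2 * n) / of_nat q) powr s *
     g_sum chi (l * k) d * g_sum chi (q * (l * k) div d) n"

definition G_series :: "nat \<Rightarrow> (int \<Rightarrow> complex) \<Rightarrow> (complex \<Rightarrow> complex) \<Rightarrow> (complex \<Rightarrow> complex) \<Rightarrow>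
    (nat \<Rightarrow> nat \<Rightarrow> complex) \<Rightarrow> nat \<Rightarrow> (int \<Rightarrow> complex) \<Rightarrow> nat \<Rightarrow> nat \<Rightarrow> complex \<Rightarrow> complex" where
  "G_series N \<psi> Gp Gm At k chi q l s =
     chi (- int N) * \<psi> (int (q * (l * k))) * by_parity chi Gp Gm s /
       (of_nat (l * k) powr (3 * s - 1) * of_nat l powr (1 - 2 * s)) *
     (\<Sum>d | d * k dvd q * (l * k). \<Sum>\<^sub>\<infinity>n\<in>{1..}. G_term At k chi q l s d n)"

definition G_converges :: "(nat \<Rightarrow> nat \<Rightarrow> complex) \<Rightarrow> nat \<Rightarrow> (int \<Rightarrow> complex) \<Rightarrow> nat \<Rightarrow> nat \<Rightarrow>
    complex \<Rightarrow> bool" where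
  "G_converges At k chi q l s \<longleftrightarrow>
     (\<forall>d. d * k dvd q * (l * k) \<longrightarrow> G_term At k chi q l s d summable_on {1..})"

definition bold_sum :: "(int \<Rightarrow> complex) \<Rightarrow> (int \<Rightarrow> complex) \<Rightarrow> nat \<Rightarrow> nat \<Rightarrow>
    (nat \<Rightarrow> nat \<Rightarrow> complex \<Rightarrow> complex) \<Rightarrow> complex \<Rightarrow> complex" where
  "bold_sum \<psi> chi q m X s =
     (\<Sum>d2 | d2 dvd q. \<Sum>(d1, l) | d1 * l = m.
        \<psi> (int d2) * chi (int (d1 * d2)) / of_nat d2 powr s * X (q * d1 div d2) l s)"

definition bold_H :: "(int \<Rightarrow> complex) \<Rightarrow> (nat \<Rightarrow> nat \<Rightarrow> complex) \<Rightarrow> nat \<Rightarrow> (int \<Rightarrow> complex) \<Rightarrow>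
    nat \<Rightarrow> nat \<Rightarrow> complex \<Rightarrow> complex" where
  "bold_H \<psi> A k chi q m = bold_sum \<psi> chi q m (H_series A k chi)"

definition bold_G :: "nat \<Rightarrow> (int \<Rightarrow> complex) \<Rightarrow> (complex \<Rightarrow> complex) \<Rightarrow> (complex \<Rightarrow> complex) \<Rightarrow>
    (nat \<Rightarrow> nat \<Rightarrow> complex) \<Rightarrow> nat \<Rightarrow> (int \<Rightarrow> complex) \<Rightarrow> nat \<Rightarrow> nat \<Rightarrow> complex \<Rightarrow> complex" where
  "bold_G N \<psi> Gp Gm At k chi q m = bold_sum \<psi> chi q m (G_series N \<psi> Gp Gm At k chi)"

end

theory Submission
  imports Defs "HOL-Number_Theory.Residues"
begin

text \<open>
  Sorting the residues modulo \<open>m * k\<close> by their gcd with \<open>m\<close> gives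
  \<open>\<Sum>\<^bsub>d l = m\<^esub> chi(d) g(chi, l k, n) = m cnj(chi(n/m)) \<tau>(chi)\<close> if \<open>m\<close> divides \<open>n\<close>, and 0 otherwise.
  With its Moebius inversion, the Hecke relations turn the bold \<open>H\<close> into
  \<open>\<tau>(cnj chi) L(s, F \<times> chi) P(s)\<close> with the Dirichlet polynomial
  \<open>P(s) = \<Sum>\<^bsub>e M = m\<^esub> \<mu>(e) cnj(chi(e)) e\<^bsup>2s-1\<^esup> M\<^bsup>s\<^esup> A(q, M)\<close>, which is the entire continuation.
  The same identity, used once in \<open>m\<close> and once in \<open>q\<close>, collapses the bold \<open>G\<close> to
  \<open>\<tau>(chi)\<^sup>2\<close> times a finite combination of twisted series of \<open>At\<close>; by the dual Hecke relations this
  combination is \<open>L(1 - s, Ft \<times> cnj chi) P(s)\<close>.  The functional equation and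
  \<open>\<tau>(chi) \<tau>(cnj chi) = chi(-1) k\<close> then identify both sides.  Convergence comes from the trivial
  character modulo 1, again through the Hecke relations.
\<close>

section \<open>Sums over factorisations\<close>

lemma factor_pairs_eq_image:
  assumes "m > (0::nat)"
  shows "{(a, b). a * b = m} = (\<lambda>a. (a, m div a)) ` {a. a dvd m}"
  using assms by (auto simp: image_iff)

lemma finite_factor_pairs: "m > (0::nat) \<Longrightarrow> finite {(a, b). a * b = m}"
  by (simp add: factor_pairs_eq_image)

lemma sum_factor_pairs:
  assumes "m > (0::nat)"
  shows "(\<Sum>(a, b) | a * b = m. f a b) = (\<Sum>a | a dvd m. f a (m div a))"
  unfolding factor_pairs_eq_image[OF assms]
  by (subst sum.reindex) (auto simp: inj_on_def)

lemma sum_factor_pairs_commute: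
  "(\<Sum>(a, b) | a * b = (m::nat). f a b) = (\<Sum>(a, b) | a * b = m. f b a)"
  by (rule sum.reindex_bij_witness[of _ "\<lambda>(a, b). (b, a)" "\<lambda>(a, b). (b, a)"])
    (auto simp: mult.commute)

lemma sum_factor_pairs_cong:
  assumes "m > (0::nat)" "\<And>a b. a > 0 \<Longrightarrow> b > 0 \<Longrightarrow> a * b = m \<Longrightarrow> f a b = g a b"
  shows "(\<Sum>(a, b) | a * b = m. f a b) = (\<Sum>(a, b) | a * b = m. g a b)"
  using assms by (intro sum.cong) (auto intro!: assms(2) simp: neq0_conv[symmetric] simp del: neq0_conv)

text \<open>Both sides run over the triples with \<open>a * b * c = m\<close>. This is associativity
  of Dirichlet convolution for weights that may depend jointly on all three factors.\<close>

lemma sum_factor_pairs_assoc: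
  assumes "m > (0::nat)"
  shows "(\<Sum>(a, x) | a * x = m. \<Sum>(b, c) | b * c = x. f a b c) =
         (\<Sum>(x, c) | x * c = m. \<Sum>(a, b) | a * b = x. f a b c)"
proof -
  have "(\<Sum>(a, x) | a * x = m. \<Sum>(b, c) | b * c = x. f a b c) =
        (\<Sum>((a, x), (b, c)) \<in> (SIGMA p:{(a, x). a * x = m}. {(b, c). b * c = snd p}). f a b c)"
    unfolding case_prod_unfold
    using assms finite_factor_pairs[unfolded case_prod_unfold]
    by (subst sum.Sigma) (auto simp: case_prod_unfold intro!: Nat.gr0I)
  also have "\<dots> = (\<Sum>((x, c), (a, b)) \<in> (SIGMA p:{(x, c). x * c = m}. {(a, b). a * b = fst p}). f a b c)"
    by (rule sum.reindex_bij_witness[of _ "\<lambda>((x, c), (a, b)). ((a, b * c), (b, c))"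
          "\<lambda>((a, x), (b, c)). ((a * b, c), (a, b))"]) (auto simp: mult.assoc)
  also have "\<dots> = (\<Sum>(x, c) | x * c = m. \<Sum>(a, b) | a * b = x. f a b c)"
    unfolding case_prod_unfold
    using assms finite_factor_pairs[unfolded case_prod_unfold]
    by (subst sum.Sigma) (auto simp: case_prod_unfold intro!: Nat.gr0I)
  finally show ?thesis .
qed

section \<open>Moebius function and inversion against completely multiplicative weights\<close>

text \<open>Taking the divisor-sum identity itself as the recursion gives the Moebius function with
  complex values and makes that identity immediate. At 0 the value is 1 by convention.\<close>

function moebius_mu :: "nat \<Rightarrow> complex" where
  "moebius_mu n = (if n \<le> 1 then 1 else - (\<Sum>d \<in> {d. d dvd n \<and> d < n}. moebius_mu d))"
  by auto
termination by (relation "Wellfounded.measure id") auto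

declare moebius_mu.simps [simp del]

lemma sum_moebius_mu:
  assumes "n > 0"
  shows "(\<Sum>d | d dvd n. moebius_mu d) = (if n = 1 then 1 else 0)"
proof (cases "n = 1")
  case True
  then show ?thesis by (simp add: moebius_mu.simps)
next
  case False
  have "{d. d dvd n} = insert n {d. d dvd n \<and> d < n}"
    using assms by (auto simp: dvd_imp_le le_neq_implies_less)
  then have "(\<Sum>d | d dvd n. moebius_mu d) = moebius_mu n + (\<Sum>d | d dvd n \<and> d < n. moebius_mu d)"
    using assms by simp
  then show ?thesis using False assms by (simp add: moebius_mu.simps[of n])
qed

text \<open>The weight depends on \<open>a * b\<close> only, so it leaves the sum and the divisor
  sum of the Moebius function remains. This is applied once two indices have merged into their
  product.\<close>

lemma sum_factor_pairs_moebius: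
  assumes "m > 0"
  shows "(\<Sum>(a, b) | a * b = m. moebius_mu a * g (a * b)) = (if m = 1 then g 1 else 0)"
proof -
  have "(\<Sum>(a, b) | a * b = m. moebius_mu a * g (a * b)) = (\<Sum>(a, b) | a * b = m. moebius_mu a) * g m"
    unfolding sum_distrib_right by (intro sum.cong) auto
  also have "(\<Sum>(a, b) | a * b = m. moebius_mu a) = (\<Sum>d | d dvd m. moebius_mu d)"
    using sum_factor_pairs[OF assms, of "\<lambda>a b. moebius_mu a"] by simp
  finally show ?thesis using assms by (simp add: sum_moebius_mu)
qed

text \<open>The Dirichlet inverse of a completely multiplicative \<open>h\<close> is its pointwise
  product with the Moebius function. After \<open>F\<close> is expanded, \<open>e\<close> and
  \<open>a\<close> merge into \<open>x = e * a\<close>, and only \<open>x = 1\<close>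
  survives.\<close>

lemma moebius_inversion:
  assumes "m > 0" and mult: "\<And>a b. h (a * b) = h a * (h b :: complex)" and "h 1 = 1"
    and F: "\<And>x. x > 0 \<Longrightarrow> F x = (\<Sum>(a, l) | a * l = x. h a * g l)"
  shows "g m = (\<Sum>(e, f) | e * f = m. moebius_mu e * h e * F f)"
proof -
  have "(\<Sum>(e, f) | e * f = m. moebius_mu e * h e * F f) =
        (\<Sum>(e, f) | e * f = m. \<Sum>(a, l) | a * l = f. moebius_mu e * h (e * a) * g l)"
    by (rule sum_factor_pairs_cong[OF assms(1)])
      (simp add: F sum_distrib_left case_prod_unfold mult mult.assoc)
  also have "\<dots> = (\<Sum>(x, l) | x * l = m. \<Sum>(e, a) | e * a = x. moebius_mu e * (h (e * a) * g l))"
    by (subst sum_factor_pairs_assoc[OF assms(1)]) (simp add: mult.assoc)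
  also have "\<dots> = (\<Sum>(x, l) | x * l = m. if x = 1 then g l else 0)"
  proof (rule sum_factor_pairs_cong[OF assms(1)])
    fix x l :: nat assume "x > 0"
    from sum_factor_pairs_moebius[OF this, of "\<lambda>x. h x * g l"]
    show "(\<Sum>(e, a) | e * a = x. moebius_mu e * (h (e * a) * g l)) = (if x = 1 then g l else 0)"
      by (simp only: assms(3) mult_1_left)
  qed
  also have "\<dots> = g m"
    using assms(1) by (simp add: sum_factor_pairs sum.If_cases if_distrib cong: if_cong)
  finally show ?thesis by simp
qed

section \<open>Dirichlet characters\<close>

lemma dirichlet_character_mult: "dirichlet_character k chi \<Longrightarrow> chi (a * b) = chi a * chi b"
  by (simp add: dirichlet_character_def)

lemma dirichlet_character_eq_0_iff:
  "dirichlet_character k chi \<Longrightarrow> chi a = 0 \<longleftrightarrow> \<not> coprime a (int k)"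
  by (auto simp: dirichlet_character_def)

lemma dirichlet_character_pos: "dirichlet_character k chi \<Longrightarrow> k > 0"
  by (auto simp: dirichlet_character_def)

lemma dirichlet_character_one: "dirichlet_character k chi \<Longrightarrow> chi 1 = 1"
  using dirichlet_character_mult[of k chi 1 1] dirichlet_character_eq_0_iff[of k chi 1] by auto

lemma dirichlet_character_add_mult:
  assumes "dirichlet_character k chi"
  shows "chi (a + int k * int j) = chi a"
proof (induction j)
  case (Suc j)
  have "chi (a + int k * int j + int k) = chi (a + int k * int j)"
    using assms by (simp add: dirichlet_character_def)
  with Suc show ?case by (simp add: algebra_simps)
qed simp

text \<open>The definition allows shifts by \<open>+ k\<close> only. A nonnegative quotient is
  handled by adding multiples of \<open>k\<close> to \<open>x mod k\<close>, a negative one by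
  adding them to \<open>x\<close>.\<close>

lemma dirichlet_character_cong:
  assumes "dirichlet_character k chi" "[a = b] (mod int k)"
  shows "chi a = chi b"
proof -
  have *: "chi x = chi (x mod int k)" for x
  proof (cases "x div int k \<ge> 0")
    case True
    then obtain j where "x div int k = int j" using nonneg_int_cases by blast
    then have "x = x mod int k + int k * int j" by (metis mod_mult_div_eq)
    then show ?thesis using dirichlet_character_add_mult[OF assms(1)] by metis
  next
    case False
    then obtain j where "- (x div int k) = int j"
      using nonneg_int_cases[of "- (x div int k)"] by (meson le_cases neg_0_le_iff_le)
    then have "x div int k = - int j" by simp
    then have "x mod int k = x + int k * int j"
      by (metis add.commute diff_minus_eq_add minus_mult_div_eq_mod mult_minus_right)
    then show ?thesis using dirichlet_character_add_mult[OF assms(1)] by metis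
  qed
  show ?thesis using assms(2) *[of a] *[of b] by (simp add: cong_def)
qed

lemma dirichlet_character_mod:
  "dirichlet_character k chi \<Longrightarrow> chi (int (a mod k)) = chi (int a)"
  by (rule dirichlet_character_cong) (auto simp: cong_def of_nat_mod)

lemma dirichlet_character_power:
  "dirichlet_character k chi \<Longrightarrow> chi (a ^ n) = chi a ^ n"
  by (induction n) (auto simp: dirichlet_character_one dirichlet_character_mult)

text \<open>By Euler's theorem \<open>chi a\<close> is a root of unity; \<open>b\<close> is a
  natural representative of \<open>a\<close> to which that theorem applies.\<close>

lemma norm_dirichlet_character_coprime:
  assumes "dirichlet_character k chi" "coprime a (int k)"
  shows "norm (chi a) = 1"
proof -
  have k: "k > 0" using assms(1) dirichlet_character_pos by blast
  define b where "b = nat (a mod int k)"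
  have b: "int b = a mod int k" using k by (simp add: b_def)
  have "coprime (int b) (int k)" using assms(2) k by (simp add: b)
  then have "[b ^ totient k = 1] (mod k)" by (intro euler_theorem) simp
  then have "[int b ^ totient k = 1] (mod int k)"
    by (metis cong_int_iff of_nat_1 of_nat_power)
  then have "chi (int b ^ totient k) = 1"
    using dirichlet_character_cong[OF assms(1)] dirichlet_character_one[OF assms(1)] by metis
  then have "chi (int b) ^ totient k = 1" using dirichlet_character_power[OF assms(1)] by simp
  then have "norm (chi (int b)) ^ totient k = 1" by (metis norm_one norm_power)
  moreover have "totient k > 0" using k by simp
  ultimately have "norm (chi (int b)) = 1"
    using power_eq_1_iff[of "norm (chi (int b))" "totient k"] by simp
  moreover have "chi a = chi (int b)"
    by (rule dirichlet_character_cong[OF assms(1)]) (unfold b cong_def, simp)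
  ultimately show ?thesis by simp
qed

lemma norm_dirichlet_character_le:
  assumes "dirichlet_character k chi"
  shows "norm (chi a) \<le> 1"
proof (cases "coprime a (int k)")
  case True
  then show ?thesis using norm_dirichlet_character_coprime[OF assms] by simp
next
  case False
  then have "chi a = 0" using dirichlet_character_eq_0_iff[OF assms] by blast
  then show ?thesis by simp
qed

lemma dirichlet_character_mult_cnj:
  assumes "dirichlet_character k chi" "coprime a (int k)"
  shows "chi a * cnj (chi a) = 1"
  using norm_dirichlet_character_coprime[OF assms] complex_norm_square[of "chi a"] by simp

lemma dirichlet_character_conj_char:
  "dirichlet_character k chi \<Longrightarrow> dirichlet_character k (conj_char chi)"
  by (simp add: dirichlet_character_def conj_char_def)

lemma primitive_character_conj_char:
  "primitive_character k chi \<Longrightarrow> primitive_character k (conj_char chi)"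
  by (auto simp: primitive_character_def induced_modulus_def dirichlet_character_conj_char)
    (auto simp: conj_char_def)

text \<open>Twisting by this character gives the untwisted series, whose absolute convergence is the
  starting point for all other series.\<close>

lemma primitive_character_trivial: "primitive_character 1 (\<lambda>_. 1)"
  by (auto simp: primitive_character_def dirichlet_character_def induced_modulus_def)

lemma primitive_characterD: "primitive_character k chi \<Longrightarrow> dirichlet_character k chi"
  by (simp add: primitive_character_def)

section \<open>Gauss sums\<close>

text \<open>Natural numerators allow periodicity to be expressed by congruences of naturals, in step
  with the periodicity of the characters.\<close>

definition root_of_unity :: "nat \<Rightarrow> nat \<Rightarrow> complex" where
  "root_of_unity k j = e_unit (real j / real k)"

lemma e_unit_add: "e_unit (x + y) = e_unit x * e_unit y"
  by (simp add: e_unit_def algebra_simps flip: exp_add)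

lemma e_unit_of_nat [simp]: "e_unit (real n) = 1"
proof -
  have "e_unit (real n) = exp (of_nat n * (2 * of_real pi * \<i>))"
    by (simp add: e_unit_def mult_ac)
  also have "\<dots> = 1" by (simp only: exp_of_nat_mult) simp
  finally show ?thesis .
qed

lemma norm_e_unit [simp]: "norm (e_unit x) = 1"
  by (simp add: e_unit_def)

lemma root_of_unity_add: "root_of_unity k (a + b) = root_of_unity k a * root_of_unity k b"
  by (simp add: root_of_unity_def add_divide_distrib e_unit_add)

lemma root_of_unity_self_mult [simp]: "k > 0 \<Longrightarrow> root_of_unity k (k * a) = 1"
  by (simp add: root_of_unity_def)

lemma root_of_unity_zero [simp]: "root_of_unity k 0 = 1"
  by (simp add: root_of_unity_def e_unit_def)

lemma root_of_unity_mult: "root_of_unity k (a * n) = root_of_unity k n ^ a"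
  by (induction a) (auto simp: root_of_unity_add)

lemma root_of_unity_mod: "k > 0 \<Longrightarrow> root_of_unity k (a mod k) = root_of_unity k a"
  using root_of_unity_add[of k "a mod k" "k * (a div k)"] by simp

lemma root_of_unity_cong: "k > 0 \<Longrightarrow> [a = b] (mod k) \<Longrightarrow> root_of_unity k a = root_of_unity k b"
  using root_of_unity_mod[of k a] root_of_unity_mod[of k b] by (simp add: cong_def)

lemma root_of_unity_cancel: "d > 0 \<Longrightarrow> root_of_unity (d * k) (d * a) = root_of_unity k a"
  by (simp add: root_of_unity_def)

lemma root_of_unity_eq_1_iff:
  assumes "k > 0" shows "root_of_unity k n = 1 \<longleftrightarrow> k dvd n"
proof
  assume "root_of_unity k n = 1"
  then have "exp (2 * complex_of_real pi * \<i> * complex_of_real (real n / real k)) = 1"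
    by (simp add: root_of_unity_def e_unit_def)
  then obtain j :: int where "2 * pi * (real n / real k) = of_int (2 * j) * pi"
    by (auto simp: exp_eq_1)
  then have "real n = real_of_int j * real k" using assms by (simp add: field_simps)
  then have "int n = j * int k" by (metis of_int_eq_iff of_int_mult of_int_of_nat_eq)
  then show "k dvd n" by (metis dvd_triv_right int_dvd_int_iff)
next
  assume "k dvd n"
  then show "root_of_unity k n = 1" using assms by auto
qed

text \<open>A geometric sum whose ratio is a \<open>k\<close>-th root of unity: the ratio is 1
  exactly when \<open>k\<close> divides \<open>n\<close>, and otherwise the numerator
  vanishes.\<close>

lemma sum_root_of_unity:
  assumes "k > 0"
  shows "(\<Sum>u<k. root_of_unity k (u * n)) = (if k dvd n then of_nat k else 0)"
proof (cases "k dvd n")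
  case True
  then have "root_of_unity k n = 1" using assms by (simp add: root_of_unity_eq_1_iff)
  then show ?thesis using True by (simp add: root_of_unity_mult)
next
  case False
  then have "root_of_unity k n \<noteq> 1" using assms by (simp add: root_of_unity_eq_1_iff)
  then show ?thesis
    using assms False by (simp add: root_of_unity_mult sum_gp_strict) (simp flip: root_of_unity_mult)
qed

lemma gauss_sum_eq: "gauss_sum k chi = (\<Sum>u<k. chi (int u) * root_of_unity k u)"
  by (simp add: gauss_sum_def root_of_unity_def)

lemma g_sum_eq:
  "g_sum chi C n = (\<Sum>u | 1 \<le> u \<and> u \<le> C \<and> coprime u C. chi (int u) * root_of_unity C (u * n))"
  by (simp add: g_sum_def root_of_unity_def mult.commute)

text \<open>The bound is uniform in \<open>n\<close>, so weighting a series by these sums preserves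
  absolute convergence.\<close>

lemma norm_g_sum_le:
  assumes "dirichlet_character k chi"
  shows "norm (g_sum chi C n) \<le> real C"
proof -
  have "norm (g_sum chi C n) \<le> (\<Sum>u | 1 \<le> u \<and> u \<le> C \<and> coprime u C. 1)"
    unfolding g_sum_def
    by (rule sum_norm_le) (use norm_dirichlet_character_le[OF assms] in \<open>auto simp: norm_mult\<close>)
  also have "\<dots> = real (card {u. 1 \<le> u \<and> u \<le> C \<and> coprime u C})" by simp
  also have "\<dots> \<le> real (card {1..C})"
    by (intro of_nat_mono card_mono) auto
  finally show ?thesis by simp
qed

text \<open>Multiplication by a unit \<open>a\<close> permutes the residues modulo
  \<open>k\<close>.\<close>

lemma twisted_gauss_sum_mult:
  assumes chi: "dirichlet_character k chi" and "coprime a k"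
  shows "(\<Sum>v<k. chi (int v) * root_of_unity k (v * n)) =
         chi (int a) * (\<Sum>v<k. chi (int v) * root_of_unity k (v * (a * n)))"
proof -
  have k: "k > 0" using chi dirichlet_character_pos by blast
  have inj: "inj_on (\<lambda>v. (a * v) mod k) {..<k}"
  proof (rule inj_onI)
    fix x y assume xy: "x \<in> {..<k}" "y \<in> {..<k}" "a * x mod k = a * y mod k"
    then have "[x = y] (mod k)" using assms(2) by (simp add: cong_def[symmetric] cong_mult_lcancel_nat)
    then show "x = y" using xy by (simp add: cong_def)
  qed
  have "bij_betw (\<lambda>v. (a * v) mod k) {..<k} {..<k}"
    unfolding bij_betw_def using inj k by (intro conjI endo_inj_surj) auto
  then have "(\<Sum>v<k. chi (int v) * root_of_unity k (v * n)) =
        (\<Sum>v<k. chi (int ((a * v) mod k)) * root_of_unity k (((a * v) mod k) * n))"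
    by (rule sum.reindex_bij_betw[symmetric])
  also have "\<dots> = (\<Sum>v<k. chi (int a) * (chi (int v) * root_of_unity k (v * (a * n))))"
  proof (rule sum.cong[OF refl])
    fix v
    have "root_of_unity k (((a * v) mod k) * n) = root_of_unity k (v * (a * n))"
      by (rule root_of_unity_cong[OF k]) (simp add: cong_def mod_simps mult_ac)
    then show "chi (int ((a * v) mod k)) * root_of_unity k (((a * v) mod k) * n) =
        chi (int a) * (chi (int v) * root_of_unity k (v * (a * n)))"
      using dirichlet_character_mult[OF chi, of "int a" "int v"]
        dirichlet_character_mod[OF chi, of "a * v"] by (simp add: mult_ac)
  qed
  finally show ?thesis by (simp add: sum_distrib_left)
qed

text \<open>For \<open>n\<close> coprime to \<open>k\<close> the substitution by the unit
  \<open>n\<close> reduces to frequency 1. Otherwise both sides vanish, and this is where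
  primitivity enters.\<close>

lemma twisted_gauss_sum_primitive:
  assumes prim: "primitive_character k chi"
  shows "(\<Sum>v<k. chi (int v) * root_of_unity k (v * n)) = cnj (chi (int n)) * gauss_sum k chi"
proof -
  note chi = primitive_characterD[OF prim]
  have k: "k > 0" using chi dirichlet_character_pos by blast
  show ?thesis
  proof (cases "coprime n k")
    case True
    have "gauss_sum k chi = chi (int n) * (\<Sum>v<k. chi (int v) * root_of_unity k (v * n))"
      using twisted_gauss_sum_mult[OF chi True, of 1] by (simp add: gauss_sum_eq)
    moreover have "chi (int n) * cnj (chi (int n)) = 1"
      using True by (intro dirichlet_character_mult_cnj[OF chi]) simp
    ultimately show ?thesis by (simp add: mult_ac)
  next
    case False
    \<comment> \<open>A common factor of \<open>n\<close> and \<open>k\<close> makes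
      \<open>d\<close> a proper divisor of \<open>k\<close>. Primitivity excludes \<open>d\<close>
      as an induced modulus and so supplies a unit \<open>a\<close>, reduced to \<open>b\<close>,
      with \<open>b = 1\<close> modulo \<open>d\<close> and \<open>chi b \<noteq> 1\<close>.\<close>
    define d where "d = k div gcd n k"
    have dk: "d * gcd n k = k" unfolding d_def by (rule dvd_div_mult_self) simp
    have "gcd n k \<noteq> 1" using False by (simp add: coprime_iff_gcd_eq_1)
    have "d \<noteq> k"
    proof
      assume "d = k"
      then have "k * gcd n k = k * 1" using dk by simp
      then show False using \<open>gcd n k \<noteq> 1\<close> k by (simp only: mult_cancel1) simp
    qed
    have "d dvd k" using dk by (metis dvd_triv_left)
    from \<open>d \<noteq> k\<close> prim have "\<not> induced_modulus k chi d" by (auto simp: primitive_character_def)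
    with \<open>d dvd k\<close> obtain a where a: "coprime a (int k)" "a mod int d = 1 mod int d" "chi a \<noteq> 1"
      by (auto simp: induced_modulus_def)
    define b where "b = nat (a mod int k)"
    have b: "int b = a mod int k" using k by (simp add: b_def)
    have "coprime (int b) (int k)" using a(1) k by (simp add: b)
    then have cb: "coprime b k" by simp
    have chib: "chi (int b) \<noteq> 1"
      using a(3) dirichlet_character_cong[OF chi, of a "int b"] by (simp add: b cong_def)
    have "int b mod int d = 1 mod int d" using a(2) \<open>d dvd k\<close> by (simp add: b mod_mod_cancel)
    then have "[int b = int 1] (mod int d)" by (simp add: cong_def)
    then have bd: "[b = 1] (mod d)" unfolding cong_int_iff .
    \<comment> \<open>Scaling by \<open>gcd n k\<close> lifts the congruence from modulus
      \<open>d\<close> to modulus \<open>k\<close>. Thus multiplication by \<open>b\<close> fixes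
      the frequency \<open>n\<close>, and the sum equals \<open>chi b\<close> times itself.\<close>
    then have "[b * gcd n k = gcd n k] (mod (d * gcd n k))"
      by (metis cong_def mod_mult_mult2 mult_1)
    then have "[b * gcd n k * (n div gcd n k) = gcd n k * (n div gcd n k)] (mod k)"
      unfolding dk by (rule cong_scalar_right)
    then have bn: "[b * n = n] (mod k)" by (simp add: mult.assoc)
    have "root_of_unity k (v * (b * n)) = root_of_unity k (v * n)" for v
      by (rule root_of_unity_cong[OF k]) (use bn in \<open>rule cong_scalar_left\<close>)
    then have "(\<Sum>v<k. chi (int v) * root_of_unity k (v * n)) =
        chi (int b) * (\<Sum>v<k. chi (int v) * root_of_unity k (v * n))"
      by (intro trans[OF twisted_gauss_sum_mult[OF chi cb, of n]]) simp
    then have "(\<Sum>v<k. chi (int v) * root_of_unity k (v * n)) = 0"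
      using chib by simp
    moreover have "chi (int n) = 0" using False dirichlet_character_eq_0_iff[OF chi] by simp
    ultimately show ?thesis by simp
  qed
qed

text \<open>Each \<open>cnj (chi u) * gauss_sum k chi\<close> is a twisted sum over
  \<open>v\<close>. After the sums are exchanged, orthogonality in \<open>u\<close> leaves only
  \<open>v = -1\<close> modulo \<open>k\<close>.\<close>

lemma gauss_sum_mult_conj:
  assumes prim: "primitive_character k chi"
  shows "gauss_sum k chi * gauss_sum k (conj_char chi) = chi (- 1) * of_nat k"
proof -
  note chi = primitive_characterD[OF prim]
  have k: "k > 0" using chi dirichlet_character_pos by blast
  have "gauss_sum k chi * gauss_sum k (conj_char chi) =
      (\<Sum>u<k. (cnj (chi (int u)) * gauss_sum k chi) * root_of_unity k u)"
    by (simp add: gauss_sum_eq[of k "conj_char chi"] conj_char_def sum_distrib_left mult_ac)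
  also have "\<dots> = (\<Sum>u<k. \<Sum>v<k. chi (int v) * root_of_unity k (u * (v + 1)))"
    unfolding twisted_gauss_sum_primitive[OF prim, symmetric] sum_distrib_right
    by (simp add: root_of_unity_add mult_ac)
  also have "\<dots> = (\<Sum>v<k. chi (int v) * (if k dvd v + 1 then of_nat k else 0))"
    by (subst sum.swap) (simp only: sum_distrib_left[symmetric] sum_root_of_unity[OF k])
  \<comment> \<open>The representative of -1 in the range is \<open>k - 1\<close>, which also covers
    \<open>k = 1\<close>, where it is 0.\<close>
  also have "\<dots> = (\<Sum>v<k. if v = k - 1 then chi (int v) * of_nat k else 0)"
  proof (rule sum.cong[OF refl])
    fix v assume "v \<in> {..<k}"
    then have "k dvd v + 1 \<longleftrightarrow> v = k - 1" using k by (auto dest: dvd_imp_le)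
    then show "chi (int v) * (if k dvd v + 1 then of_nat k else 0) =
        (if v = k - 1 then chi (int v) * of_nat k else 0)" by simp
  qed
  also have "\<dots> = chi (int (k - 1)) * of_nat k" using k by simp
  also have "chi (int (k - 1)) = chi (- 1)"
    by (rule dirichlet_character_cong[OF chi]) (use k in \<open>simp add: cong_iff_dvd_diff of_nat_diff\<close>)
  finally show ?thesis .
qed

section \<open>Two evaluations of a complete character sum modulo \<open>m * k\<close>\<close>

text \<open>Put \<open>d = gcd u m\<close> and \<open>u = d * v\<close>. Then \<open>chi d\<close>
  splits off, the exponential cancels to modulus \<open>l * k\<close> with
  \<open>l = m div d\<close>, and \<open>v\<close> is coprime to \<open>l\<close>.\<close>

lemma complete_sum_by_gcd:
  assumes chi: "dirichlet_character k chi" and "m > 0"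
  shows "(\<Sum>u<m * k. chi (int u) * root_of_unity (m * k) (u * n)) =
         (\<Sum>(d, l) | d * l = m. chi (int d) * g_sum chi (l * k) n)"
proof -
  have k: "k > 0" using chi dirichlet_character_pos by blast
  define f where "f u = chi (int u) * root_of_unity (m * k) (u * n)" for u
  \<comment> \<open>The terms at 0 and \<open>m * k\<close> agree, so the range may be shifted to
    \<open>1..m * k\<close>, matching the range in \<open>g_sum\<close>.\<close>
  have "chi (int (m * k)) = chi (int 0)"
    by (rule dirichlet_character_cong[OF chi]) (simp add: cong_def)
  moreover have "root_of_unity (m * k) (m * k * n) = 1"
    using k assms(2) by (intro root_of_unity_self_mult) simp
  ultimately have f0: "f (m * k) = f 0" by (simp only: f_def) simp
  obtain C where C: "m * k = Suc C" using k assms(2) by (metis mult_pos_pos gr0_implies_Suc)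
  have "(\<Sum>u<m * k. f u) = f 0 + (\<Sum>u<C. f (Suc u))"
    unfolding C by (rule sum.lessThan_Suc_shift)
  also have "\<dots> = (\<Sum>u\<in>{1..m * k}. f u)"
    using f0 unfolding C by (simp add: sum.atLeast1_atMost_eq)
  finally have "(\<Sum>u<m * k. f u) = (\<Sum>u\<in>{1..m * k}. f u)" .
  also have "\<dots> = (\<Sum>d | d dvd m. \<Sum>u | u \<in> {1..m * k} \<and> gcd u m = d. f u)"
    using assms(2) by (intro sum.group[symmetric]) auto
  also have "\<dots> = (\<Sum>d | d dvd m. chi (int d) * g_sum chi (m div d * k) n)"
  proof (rule sum.cong[OF refl])
    fix d assume "d \<in> {d. d dvd m}"
    then obtain l where m: "m = d * l" by auto
    with assms(2) have d: "d > 0" "l > 0" by auto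
    have "{u. u \<in> {1..m * k} \<and> gcd u m = d} =
        (\<lambda>u. d * u) ` {u. 1 \<le> u \<and> u \<le> l * k \<and> coprime u l}" (is "?L = ?R")
    proof (intro equalityI subsetI)
      fix u assume u: "u \<in> ?L"
      then have "d dvd u" by (metis (mono_tags, lifting) gcd_dvd1 mem_Collect_eq)
      then obtain v where v: "u = d * v" by blast
      have "d * gcd v l = d" using u by (simp add: v m gcd_mult_distrib_nat)
      then have "coprime v l" using d by (simp add: coprime_iff_gcd_eq_1)
      moreover have "1 \<le> v \<and> v \<le> l * k" using u d by (auto simp: v m mult.assoc intro: Nat.gr0I)
      ultimately show "u \<in> ?R" using v by blast
    next
      fix u assume "u \<in> ?R"
      then obtain v where v: "u = d * v" "1 \<le> v" "v \<le> l * k" "coprime v l" by blast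
      have "gcd u m = d" using v by (simp add: m gcd_mult_distrib_nat[symmetric])
      moreover have "1 \<le> u" "u \<le> m * k" using v d by (auto simp: m mult.assoc)
      ultimately show "u \<in> ?L" by simp
    qed
    then have "(\<Sum>u | u \<in> {1..m * k} \<and> gcd u m = d. f u) =
          (\<Sum>u | 1 \<le> u \<and> u \<le> l * k \<and> coprime u l. f (d * u))"
      using d by (simp add: sum.reindex inj_on_def)
    \<comment> \<open>Requiring coprimality to \<open>k\<close> as well removes only terms where
      \<open>chi\<close> vanishes.\<close>
    also have "\<dots> = (\<Sum>u | 1 \<le> u \<and> u \<le> l * k \<and> coprime u (l * k). f (d * u))"
    proof (rule sum.mono_neutral_right)
      show "finite {u. 1 \<le> u \<and> u \<le> l * k \<and> coprime u l}"
        by (rule finite_subset[of _ "{..l * k}"]) auto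
      show "\<forall>u \<in> {u. 1 \<le> u \<and> u \<le> l * k \<and> coprime u l} - {u. 1 \<le> u \<and> u \<le> l * k \<and> coprime u (l * k)}.
          f (d * u) = 0"
      proof
        fix u assume "u \<in> {u. 1 \<le> u \<and> u \<le> l * k \<and> coprime u l} -
            {u. 1 \<le> u \<and> u \<le> l * k \<and> coprime u (l * k)}"
        then have "\<not> coprime (int u) (int k)" by simp
        then have "chi (int u) = 0" using dirichlet_character_eq_0_iff[OF chi] by blast
        then show "f (d * u) = 0" by (simp add: f_def dirichlet_character_mult[OF chi])
      qed
    qed auto
    also have "\<dots> = chi (int d) * g_sum chi (l * k) n"
    proof -
      have "f (d * u) = chi (int d) * (chi (int u) * root_of_unity (l * k) (u * n))" for u
        using root_of_unity_cancel[of d "l * k" "u * n"] d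
        by (simp add: f_def m mult.assoc dirichlet_character_mult[OF chi])
      then show ?thesis by (simp add: g_sum_eq sum_distrib_left)
    qed
    finally show "(\<Sum>u | u \<in> {1..m * k} \<and> gcd u m = d. f u) = chi (int d) * g_sum chi (m div d * k) n"
      using d by (simp add: m)
  qed
  also have "\<dots> = (\<Sum>(d, l) | d * l = m. chi (int d) * g_sum chi (l * k) n)"
    by (rule sum_factor_pairs[OF assms(2), symmetric])
  finally show ?thesis unfolding f_def .
qed

text \<open>Write \<open>u = k * w + v\<close>. The character sees only \<open>v\<close>;
  orthogonality in \<open>w\<close> forces \<open>m\<close> to divide \<open>n\<close>, and the sum
  over \<open>v\<close> is then a twisted Gauss sum of frequency \<open>n div m\<close>.\<close>

lemma complete_sum_primitive:
  assumes prim: "primitive_character k chi" and m: "m > 0"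
  shows "(\<Sum>u<m * k. chi (int u) * root_of_unity (m * k) (u * n)) =
         (if m dvd n then of_nat m * cnj (chi (int (n div m))) * gauss_sum k chi else 0)"
proof -
  note chi = primitive_characterD[OF prim]
  have k: "k > 0" using chi dirichlet_character_pos by blast
  define f where "f u = chi (int u) * root_of_unity (m * k) (u * n)" for u
  have f: "f (k * w + v) = f v * root_of_unity m (w * n)" for v w
  proof -
    have "chi (int (k * w + v)) = chi (int v)"
      using dirichlet_character_add_mult[OF chi, of "int v" w] by (simp add: add.commute)
    moreover have "root_of_unity (m * k) ((k * w + v) * n) =
        root_of_unity (k * m) (k * (w * n)) * root_of_unity (m * k) (v * n)"
      by (simp add: root_of_unity_add distrib_left distrib_right mult_ac)
    ultimately show ?thesis using k by (simp add: f_def root_of_unity_cancel)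
  qed
  have "(\<Sum>u<m * k. f u) = (\<Sum>w<m. sum f {w * k..<w * k + k})"
    by (simp add: sum.nat_group)
  also have "\<dots> = (\<Sum>w<m. \<Sum>v<k. f v * root_of_unity m (w * n))"
  proof (rule sum.cong[OF refl])
    fix w
    show "sum f {w * k..<w * k + k} = (\<Sum>v<k. f v * root_of_unity m (w * n))"
      unfolding f[symmetric]
      by (rule sum.reindex_bij_witness[of _ "\<lambda>v. k * w + v" "\<lambda>u. u - k * w"]) (auto simp: mult_ac)
  qed
  also have "\<dots> = (\<Sum>v<k. f v) * (if m dvd n then of_nat m else 0)"
    unfolding sum_root_of_unity[OF m, symmetric] by (subst sum.swap) (simp add: sum_product)
  finally have *: "(\<Sum>u<m * k. f u) = (\<Sum>v<k. f v) * (if m dvd n then of_nat m else 0)" .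
  show ?thesis
  proof (cases "m dvd n")
    case True
    then obtain j where n: "n = m * j" by auto
    have "f v = chi (int v) * root_of_unity k (v * j)" for v
      using m root_of_unity_cancel[of m k "v * j"] by (simp add: f_def n mult_ac)
    then have "(\<Sum>v<k. f v) = cnj (chi (int j)) * gauss_sum k chi"
      using twisted_gauss_sum_primitive[OF prim] by simp
    then show ?thesis using * m by (simp add: f_def n)
  next
    case False
    then show ?thesis using * by (simp add: f_def)
  qed
qed

text \<open>The closed form of the complete sum for a primitive character. Its support on multiples
  of \<open>m\<close> is what collapses the sums over \<open>d\<close>, \<open>n\<close> and the
  factorisations.\<close>

definition divisor_gauss :: "nat \<Rightarrow> (int \<Rightarrow> complex) \<Rightarrow> nat \<Rightarrow> nat \<Rightarrow> complex" where
  "divisor_gauss k chi m n =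
    (if m dvd n then of_nat m * cnj (chi (int (n div m))) * gauss_sum k chi else 0)"

lemma sum_g_sum:
  assumes "primitive_character k chi" "m > 0"
  shows "(\<Sum>(d, l) | d * l = m. chi (int d) * g_sum chi (l * k) n) = divisor_gauss k chi m n"
  unfolding complete_sum_by_gcd[OF primitive_characterD[OF assms(1)] assms(2), symmetric]
    complete_sum_primitive[OF assms] divisor_gauss_def ..

text \<open>Moebius inversion of \<open>sum_g_sum\<close> in \<open>l\<close>, with weight
  \<open>chi\<close>: incomplete sums become combinations of terms supported on multiples of the
  divisors of \<open>l\<close>.\<close>

lemma g_sum_primitive:
  assumes "primitive_character k chi" "l > 0"
  shows "g_sum chi (l * k) n = (\<Sum>(e, f) | e * f = l. moebius_mu e * chi (int e) * divisor_gauss k chi f n)"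
proof (rule moebius_inversion[where h = "\<lambda>e. chi (int e)" and g = "\<lambda>l. g_sum chi (l * k) n"
      and F = "\<lambda>f. divisor_gauss k chi f n", OF assms(2)])
  note chi = primitive_characterD[OF assms(1)]
  show "chi (int (a * b)) = chi (int a) * chi (int b)" for a b
    by (simp add: dirichlet_character_mult[OF chi])
  show "chi (int 1) = 1" by (simp add: dirichlet_character_one[OF chi])
qed (rule sum_g_sum[OF assms(1), symmetric])

section \<open>Twisted Dirichlet series of Hecke coefficients\<close>

lemma of_nat_mult_powr:
  "(of_nat (a * b) :: complex) powr s = of_nat a powr s * of_nat b powr s"
  by (simp add: powr_times_real)

lemma has_sum_finite_sum:
  fixes g :: "'a \<Rightarrow> 'b \<Rightarrow> complex"
  assumes "finite I" "\<And>i. i \<in> I \<Longrightarrow> ((\<lambda>n. g i n) has_sum S i) A"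
  shows "((\<lambda>n. \<Sum>i\<in>I. g i n) has_sum (\<Sum>i\<in>I. S i)) A"
  using assms by (induction I rule: finite_induct) (auto intro!: has_sum_add)

text \<open>Reindexing by multiples of \<open>c\<close> and filling the gaps with zeros leaves the
  value unchanged.\<close>

lemma has_sum_dilate:
  assumes "c > (0::nat)" "(f has_sum S) {1..}"
  shows "((\<lambda>n. if c dvd n then f (n div c) else 0) has_sum (S :: complex)) {1..}"
proof -
  define g where "g n = (if c dvd n then f (n div c) else 0)" for n
  have "(g \<circ> (*) c) = f" using assms(1) by (auto simp: g_def fun_eq_iff)
  then have "(g has_sum S) ((*) c ` {1..})"
    using assms by (subst has_sum_reindex) (auto simp: inj_on_def)
  also have "(g has_sum S) ((*) c ` {1..}) \<longleftrightarrow> (g has_sum S) {1..}"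
  proof (rule has_sum_cong_neutral)
    fix n assume "n \<in> {1..} - (*) c ` {1..}"
    then show "g n = 0" by (auto simp: g_def elim!: dvdE)
  qed (use assms(1) in auto)
  finally show ?thesis unfolding g_def .
qed

lemma summable_on_dilate:
  assumes "c > (0::nat)" "(f :: nat \<Rightarrow> complex) summable_on {1..}"
  shows "(\<lambda>n. f (n * c)) summable_on {1..}"
proof -
  have "f summable_on ((\<lambda>n. n * c) ` {1..})"
    by (rule summable_on_subset_banach[OF assms(2)]) (use assms(1) in auto)
  then show ?thesis
    using assms(1) by (subst (asm) summable_on_reindex) (auto simp: inj_on_def o_def)
qed

text \<open>For complex series \<open>summable_on\<close> is absolute summability, so comparison
  with \<open>K\<close> times the norms suffices.\<close>

lemma summable_on_bounded_weight:
  assumes "(f :: nat \<Rightarrow> complex) summable_on S" "\<And>n. n \<in> S \<Longrightarrow> norm (w n) \<le> K"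
  shows "(\<lambda>n. f n * w n) summable_on S"
proof -
  have "(\<lambda>n. norm (f n)) summable_on S"
    using assms(1) summable_on_iff_abs_summable_on_complex by blast
  then have "(\<lambda>n. norm (f n) * K) summable_on S" by (rule summable_on_cmult_left)
  then have "(\<lambda>n. norm (f n * w n)) summable_on S"
    by (rule Infinite_Sum.abs_summable_on_comparison_test')
      (use assms(2) in \<open>auto simp: norm_mult intro!: mult_left_mono\<close>)
  then show ?thesis using summable_on_iff_abs_summable_on_complex by blast
qed

section \<open>Hecke relations summed against a completely multiplicative twist\<close>

text \<open>Treats both families at once: \<open>B\<close> is \<open>A\<close> with
  \<open>\<omega>\<close>, \<open>\<eta>\<close> given by \<open>\<psi>\<close>, \<open>chi\<close>,
  or \<open>At\<close> with their conjugates. The convergence assumption concerns the untwisted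
  first row only.\<close>

locale twisted_hecke =
  fixes N :: nat and \<omega> \<eta> :: "nat \<Rightarrow> complex" and B :: "nat \<Rightarrow> nat \<Rightarrow> complex" and \<sigma> :: real
  assumes hecke: "\<And>r n1 n2. r > 0 \<Longrightarrow> n1 > 0 \<Longrightarrow> n2 > 0 \<Longrightarrow> coprime (n1 * n2) N \<Longrightarrow>
           B 1 r * B n2 n1 =
           (\<Sum>(a, b, c) | a * b * c = r \<and> b dvd n1 \<and> c dvd n2.
              B (b * n2 div c) (a * n1 div b) * \<omega> c)"
    and omega_one: "\<omega> 1 = 1"
    and summable_first_row: "\<And>s. Re s > \<sigma> \<Longrightarrow> (\<lambda>n. B 1 n * of_nat n powr (- s)) summable_on {1..}"
    and twist_mult: "\<And>a b. \<eta> (a * b) = \<eta> a * \<eta> b"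
    and norm_twist_le: "\<And>a. norm (\<eta> a) \<le> 1"
begin

text \<open>The common building blocks of both sides. The twist and the power see \<open>a\<close>
  and not \<open>M\<close>; for \<open>Q = M = 1\<close> this is the twisted L-series.\<close>

definition twisted_series :: "nat \<Rightarrow> nat \<Rightarrow> complex \<Rightarrow> complex" where
  "twisted_series Q M s = (\<Sum>\<^sub>\<infinity>a\<in>{1..}. B Q (a * M) * \<eta> a * of_nat a powr (- s))"

text \<open>The factor \<open>a\<close> is determined by \<open>b\<close>, \<open>c\<close> and
  \<open>r\<close>. The remaining index ranges do not depend on \<open>r\<close>, so they can be
  exchanged with a sum over \<open>r\<close>.\<close>

lemma hecke_divisors:
  assumes "r > 0" "n1 > 0" "n2 > 0" "coprime (n1 * n2) N"
  shows "B 1 r * B n2 n1 = (\<Sum>b | b dvd n1. \<Sum>c | c dvd n2.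
     if b * c dvd r then B (b * n2 div c) (r div (b * c) * (n1 div b)) * \<omega> c else 0)"
proof -
  have "(\<Sum>(a, b, c) | a * b * c = r \<and> b dvd n1 \<and> c dvd n2.
              B (b * n2 div c) (a * n1 div b) * \<omega> c) =
      (\<Sum>(b, c) | (b, c) \<in> {b. b dvd n1} \<times> {c. c dvd n2} \<and> b * c dvd r.
              B (b * n2 div c) (r div (b * c) * (n1 div b)) * \<omega> c)"
    using assms(1)
    by (intro sum.reindex_bij_witness[of _ "\<lambda>(b, c). (r div (b * c), b, c)" "\<lambda>(a, b, c). (b, c)"])
      (auto simp: mult.assoc div_mult_swap)
  also have "\<dots> = (\<Sum>(b, c) \<in> {b. b dvd n1} \<times> {c. c dvd n2}.
     if b * c dvd r then B (b * n2 div c) (r div (b * c) * (n1 div b)) * \<omega> c else 0)"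
    using assms(2,3) sum.inter_filter[of "{b. b dvd n1} \<times> {c. c dvd n2}"
      "\<lambda>(b, c). B (b * n2 div c) (r div (b * c) * (n1 div b)) * \<omega> c" "\<lambda>(b, c). b * c dvd r"]
    unfolding case_prod_unfold mem_Times_iff by (simp add: case_prod_unfold)
  finally show ?thesis
    unfolding hecke[OF assms] by (simp add: sum.cartesian_product)
qed

text \<open>Strong induction on \<open>Q\<close>. In the Hecke relation with \<open>n1 = 1\<close>,
  the divisor \<open>c = 1\<close> contributes row \<open>Q\<close>, and every other
  \<open>c\<close> contributes the shorter-indexed row \<open>Q div c\<close> dilated by
  \<open>c\<close>. The half-plane stays the same.\<close>

lemma summable_row:
  assumes "Q > 0" "coprime Q N" "Re s > \<sigma>"
  shows "(\<lambda>n. B Q n * of_nat n powr (- s)) summable_on {1..}"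
  using assms(1,2)
proof (induction Q rule: less_induct)
  case (less Q)
  define C where "C = {c. c dvd Q} - {1}"
  have fin: "finite {c. c dvd Q}" using less.prems by simp
  define T where "T c r = (if c dvd r then B (Q div c) (r div c) * of_nat (r div c) powr (- s) else 0)" for c r
  have T: "T c summable_on {1..}" if "c \<in> C" for c
  proof -
    from that obtain x where x: "Q = c * x" and c1: "c \<noteq> 1" by (auto simp: C_def)
    with less.prems have pos: "x > 0" "c > 0" "c > 1" by (auto intro!: Nat.gr0I)
    then have "x < Q" unfolding x by simp
    moreover have "coprime x N" using less.prems x by simp
    ultimately have "(\<lambda>n. B x n * of_nat n powr (- s)) summable_on {1..}" using less.IH pos by blast
    then obtain S where "((\<lambda>n. B x n * of_nat n powr (- s)) has_sum S) {1..}"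
      by (auto simp: summable_on_def)
    then have "(T c has_sum S) {1..}"
      unfolding T_def using pos x by (intro has_sum_dilate) auto
    then show ?thesis by (rule has_sum_imp_summable)
  qed
  have "((\<lambda>r. \<Sum>c\<in>C. - \<omega> c * of_nat c powr (- s) * T c r) has_sum
      (\<Sum>c\<in>C. - \<omega> c * of_nat c powr (- s) * infsum (T c) {1..})) {1..}"
    using fin by (intro has_sum_finite_sum has_sum_cmult_right has_sum_infsum T) (auto simp: C_def)
  then have "(\<lambda>r. B 1 r * of_nat r powr (- s) * B Q 1 +
      (\<Sum>c\<in>C. - \<omega> c * of_nat c powr (- s) * T c r)) summable_on {1..}"
    by (intro summable_on_add summable_on_cmult_left summable_first_row assms(3))
      (rule has_sum_imp_summable)
  also have "(\<lambda>r. B 1 r * of_nat r powr (- s) * B Q 1 +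
      (\<Sum>c\<in>C. - \<omega> c * of_nat c powr (- s) * T c r)) summable_on {1..}
    \<longleftrightarrow> (\<lambda>n. B Q n * of_nat n powr (- s)) summable_on {1..}"
  proof (rule summable_on_cong)
    fix r :: nat assume "r \<in> {1..}"
    then have r: "r > 0" by simp
    define F where "F c = (if c dvd r then B (Q div c) (r div c) * \<omega> c else 0)" for c
    have "B 1 r * B Q 1 = (\<Sum>c | c dvd Q. F c)"
    proof -
      have "{b::nat. b dvd 1} = {1}" by auto
      then have "B 1 r * B Q 1 = (\<Sum>b\<in>{1}. \<Sum>c | c dvd Q.
          if b * c dvd r then B (b * Q div c) (r div (b * c) * (1 div b)) * \<omega> c else 0)"
        using hecke_divisors[of r 1 Q] r less.prems by (simp only: mult_1_left zero_less_one)
      then show ?thesis unfolding F_def by (simp cong: if_cong)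
    qed
    also have "\<dots> = F 1 + (\<Sum>c\<in>C. F c)"
      unfolding C_def using fin by (subst sum.remove[of _ 1]) auto
    also have "F 1 = B Q r" using omega_one by (simp add: F_def)
    finally have "B 1 r * B Q 1 * of_nat r powr (- s) =
        (B Q r + (\<Sum>c\<in>C. F c)) * of_nat r powr (- s)" by simp
    moreover have "F c * of_nat r powr (- s) = \<omega> c * of_nat c powr (- s) * T c r" for c
      by (auto simp: F_def T_def of_nat_mult_powr simp del: of_nat_mult elim!: dvdE)
    ultimately have "B 1 r * B Q 1 * of_nat r powr (- s) =
        B Q r * of_nat r powr (- s) + (\<Sum>c\<in>C. \<omega> c * of_nat c powr (- s) * T c r)"
      by (simp add: distrib_right sum_distrib_right)
    then show "B 1 r * of_nat r powr (- s) * B Q 1 + (\<Sum>c\<in>C. - \<omega> c * of_nat c powr (- s) * T c r) =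
        B Q r * of_nat r powr (- s)"
      by (simp add: sum_negf mult_ac)
  qed
  finally show ?case .
qed

text \<open>A subseries of row \<open>Q\<close>, along multiples of \<open>M\<close>, with a bounded
  weight; the constant power of \<open>M\<close> is divided out.\<close>

lemma has_sum_twisted_series:
  assumes "Q > 0" "coprime Q N" "M > 0" "Re s > \<sigma>"
  shows "((\<lambda>a. B Q (a * M) * \<eta> a * of_nat a powr (- s)) has_sum twisted_series Q M s) {1..}"
proof -
  have "(\<lambda>a. B Q (a * M) * of_nat (a * M) powr (- s)) summable_on {1..}"
    using summable_on_dilate[OF assms(3) summable_row[OF assms(1,2,4)]] .
  then have "(\<lambda>a. B Q (a * M) * of_nat (a * M) powr (- s) * \<eta> a) summable_on {1..}"
    by (rule summable_on_bounded_weight) (rule norm_twist_le)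
  then have "(\<lambda>a. inverse (of_nat M powr (- s)) * (B Q (a * M) * of_nat (a * M) powr (- s) * \<eta> a)) summable_on {1..}"
    by (rule summable_on_cmult_right)
  also have "(\<lambda>a. inverse (of_nat M powr (- s)) * (B Q (a * M) * of_nat (a * M) powr (- s) * \<eta> a)) =
      (\<lambda>a. B Q (a * M) * \<eta> a * of_nat a powr (- s))"
    unfolding of_nat_mult_powr using assms(3) by (auto simp: fun_eq_iff field_simps)
  finally show ?thesis unfolding twisted_series_def by (rule has_sum_infsum)
qed

lemma has_sum_multiples:
  assumes "Q > 0" "coprime Q N" "M > 0" "Re s > \<sigma>"
  shows "((\<lambda>n. B Q n * (if M dvd n then \<eta> (n div M) else 0) * of_nat n powr (- s)) has_sum
     of_nat M powr (- s) * twisted_series Q M s) {1..}"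
proof -
  have "((\<lambda>n. of_nat M powr (- s) * (if M dvd n then B Q (n div M * M) * \<eta> (n div M) * of_nat (n div M) powr (- s) else 0))
     has_sum of_nat M powr (- s) * twisted_series Q M s) {1..}"
    by (intro has_sum_cmult_right has_sum_dilate has_sum_twisted_series assms)
  also have "(\<lambda>n. of_nat M powr (- s) * (if M dvd n then B Q (n div M * M) * \<eta> (n div M) * of_nat (n div M) powr (- s) else 0)) =
      (\<lambda>n. B Q n * (if M dvd n then \<eta> (n div M) else 0) * of_nat n powr (- s))"
    using assms(3) by (auto simp: fun_eq_iff of_nat_mult_powr simp del: of_nat_mult elim!: dvdE)
  finally show ?thesis .
qed

text \<open>Multiply the Hecke relation by \<open>\<eta> r\<close> and the power of
  \<open>r\<close>, and sum over \<open>r = a * b * c\<close>: complete multiplicativity separates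
  \<open>b * c\<close> from \<open>a\<close>. Any value \<open>L\<close> of the series is allowed,
  so that a continued L-function can be inserted.\<close>

lemma twisted_hecke_relation:
  assumes L: "((\<lambda>n. B 1 n * \<eta> n * of_nat n powr (- s)) has_sum L) {1..}"
    and "n1 > 0" "n2 > 0" "coprime n1 N" "coprime n2 N" "Re s > \<sigma>"
  shows "L * B n2 n1 = (\<Sum>b | b dvd n1. \<Sum>c | c dvd n2.
     \<omega> c * \<eta> (b * c) * of_nat (b * c) powr (- s) * twisted_series (b * n2 div c) (n1 div b) s)"
proof -
  \<comment> \<open>The share of the pair \<open>(b, c)\<close> in the \<open>r\<close>-th term,
    written as a dilation by \<open>b * c\<close>.\<close>
  define T where "T b c r = \<omega> c * \<eta> (b * c) * of_nat (b * c) powr (- s) *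
    (if b * c dvd r then B (b * n2 div c) (r div (b * c) * (n1 div b)) * \<eta> (r div (b * c)) *
      of_nat (r div (b * c)) powr (- s) else 0)" for b c r
  have "((\<lambda>r. \<Sum>b | b dvd n1. \<Sum>c | c dvd n2. T b c r) has_sum (\<Sum>b | b dvd n1. \<Sum>c | c dvd n2.
     \<omega> c * \<eta> (b * c) * of_nat (b * c) powr (- s) * twisted_series (b * n2 div c) (n1 div b) s)) {1..}"
  proof (intro has_sum_finite_sum)
    fix b c assume "b \<in> {b. b dvd n1}" "c \<in> {c. c dvd n2}"
    then obtain x y where xy: "n1 = b * x" "n2 = c * y" by (auto simp: dvd_def)
    with assms have pos: "b > 0" "c > 0" "x > 0" "y > 0" by (auto intro!: Nat.gr0I)
    have "coprime (b * y) N" using assms xy by simp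
    then show "((\<lambda>r. T b c r) has_sum
       \<omega> c * \<eta> (b * c) * of_nat (b * c) powr (- s) * twisted_series (b * n2 div c) (n1 div b) s) {1..}"
      unfolding T_def using pos assms(6)
      by (intro has_sum_cmult_right has_sum_dilate[of "b * c"
            "\<lambda>a. B (b * n2 div c) (a * (n1 div b)) * \<eta> a * of_nat a powr (- s)"] has_sum_twisted_series)
        (auto simp: xy)
  qed (use assms in auto)
  also have "?this \<longleftrightarrow> ((\<lambda>r. B 1 r * \<eta> r * of_nat r powr (- s) * B n2 n1) has_sum (\<Sum>b | b dvd n1. \<Sum>c | c dvd n2.
     \<omega> c * \<eta> (b * c) * of_nat (b * c) powr (- s) * twisted_series (b * n2 div c) (n1 div b) s)) {1..}"
  proof (rule has_sum_cong)
    fix r :: nat assume "r \<in> {1..}"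
    then have r: "r > 0" by simp
    have "B 1 r * \<eta> r * of_nat r powr (- s) * B n2 n1 = (B 1 r * B n2 n1) * (\<eta> r * of_nat r powr (- s))"
      by simp
    also have "\<dots> = (\<Sum>b | b dvd n1. \<Sum>c | c dvd n2. (if b * c dvd r then
        B (b * n2 div c) (r div (b * c) * (n1 div b)) * \<omega> c else 0) * (\<eta> r * of_nat r powr (- s)))"
      using hecke_divisors[of r n1 n2] r assms by (simp add: sum_distrib_right)
    also have "\<dots> = (\<Sum>b | b dvd n1. \<Sum>c | c dvd n2. T b c r)"
    proof (intro sum.cong refl)
      fix b c
      show "(if b * c dvd r then B (b * n2 div c) (r div (b * c) * (n1 div b)) * \<omega> c else 0) *
          (\<eta> r * of_nat r powr (- s)) = T b c r"
      proof (cases "b * c dvd r")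
        case True
        then obtain a where a: "r = b * c * a" by blast
        then have "r div (b * c) = a" using r by simp
        then show ?thesis
          using True by (simp only: T_def if_True a of_nat_mult_powr twist_mult) (simp add: mult_ac)
      qed (simp add: T_def)
    qed
    finally show "(\<Sum>b | b dvd n1. \<Sum>c | c dvd n2. T b c r) = B 1 r * \<eta> r * of_nat r powr (- s) * B n2 n1" ..
  qed
  finally have 1: "((\<lambda>r. B 1 r * \<eta> r * of_nat r powr (- s) * B n2 n1) has_sum (\<Sum>b | b dvd n1. \<Sum>c | c dvd n2.
     \<omega> c * \<eta> (b * c) * of_nat (b * c) powr (- s) * twisted_series (b * n2 div c) (n1 div b) s)) {1..}" .
  have "((\<lambda>r. B 1 r * \<eta> r * of_nat r powr (- s) * B n2 n1) has_sum L * B n2 n1) {1..}"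
    by (rule has_sum_cmult_left[OF L])
  then show ?thesis using 1 by (rule has_sum_unique)
qed

end

section \<open>The series bold H and bold G\<close>

text \<open>Reorders a triple factorisation so that the middle factor becomes the outermost
  index.\<close>

lemma sum_factor_pairs_left_commute:
  assumes "m > (0::nat)"
  shows "(\<Sum>(a, x) | a * x = m. \<Sum>(b, c) | b * c = x. f a b c) =
         (\<Sum>(b, x) | b * x = m. \<Sum>(a, c) | a * c = x. f a b c)"
proof -
  have "(\<Sum>(a, x) | a * x = m. \<Sum>(b, c) | b * c = x. f a b c) =
        (\<Sum>(x, c) | x * c = m. \<Sum>(a, b) | a * b = x. f a b c)"
    by (rule sum_factor_pairs_assoc[OF assms])
  also have "\<dots> = (\<Sum>(x, c) | x * c = m. \<Sum>(b, a) | b * a = x. f a b c)"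
    by (rule sum_factor_pairs_cong[OF assms], rule sum_factor_pairs_commute)
  also have "\<dots> = (\<Sum>(b, x) | b * x = m. \<Sum>(a, c) | a * c = x. f a b c)"
    by (rule sum_factor_pairs_assoc[OF assms, symmetric])
  finally show ?thesis .
qed

lemma of_nat_mult_powr_double:
  "n > 0 \<Longrightarrow> of_nat n * of_nat n powr (2 * s - 1) = of_nat n powr s * (of_nat n powr s :: complex)"
  by (simp add: powr_diff flip: powr_add)

lemma of_nat_divide_powr:
  "(of_nat a / of_nat b :: complex) powr s = of_nat a powr s / of_nat b powr s"
proof (cases "b = 0")
  case False
  have "(of_nat a / of_nat b :: complex) powr s * of_nat b powr s = (of_nat a / of_nat b * of_nat b) powr s"
    by (rule powr_times_real[symmetric]) auto
  then show ?thesis using False by (simp add: field_simps)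
qed simp

text \<open>The finite factor \<open>P(s)\<close> common to both sides. The Moebius weight comes
  from inverting \<open>g_sum\<close>, the coefficient \<open>A q M\<close> from reassembling a
  Hecke relation.\<close>

definition hecke_polynomial :: "(nat \<Rightarrow> nat \<Rightarrow> complex) \<Rightarrow> (int \<Rightarrow> complex) \<Rightarrow> nat \<Rightarrow> nat \<Rightarrow> complex \<Rightarrow> complex" where
  "hecke_polynomial A chi q m s = (\<Sum>(e, M) | e * M = m.
     moebius_mu e * cnj (chi (int e)) * of_nat e powr (2 * s - 1) * of_nat M powr s * A q M)"

lemma holomorphic_hecke_polynomial: "hecke_polynomial A chi q m holomorphic_on UNIV"
  unfolding hecke_polynomial_def[abs_def] case_prod_unfold by (intro holomorphic_intros)

section \<open>The bold H as Gauss sum times L-series times Dirichlet polynomial\<close>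

locale H_setting = twisted_hecke N "\<lambda>c. \<psi> (int c)" "\<lambda>n. chi (int n)" A \<sigma>
  for N \<psi> chi A \<sigma> +
  fixes k :: nat
  assumes prim: "primitive_character k chi"
begin

lemmas chi = primitive_characterD[OF prim]

lemma H_converges_coprime:
  assumes "Q > 0" "coprime Q N" "Re s > \<sigma>"
  shows "H_converges A k chi Q l s"
proof -
  have "(\<lambda>n. A Q n * of_nat n powr (- s) * g_sum (conj_char chi) (l * k) n) summable_on {1..}"
    by (rule summable_on_bounded_weight[OF summable_row[OF assms]])
      (rule norm_g_sum_le[OF dirichlet_character_conj_char[OF chi]])
  then have "(\<lambda>n. A Q n * of_nat n powr (- s) * g_sum (conj_char chi) (l * k) n *
      inverse (of_nat l powr (1 - 2 * s))) summable_on {1..}"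
    by (rule summable_on_cmult_left)
  then show ?thesis
    unfolding H_converges_def H_term_def[abs_def] by (simp add: powr_minus field_simps)
qed

text \<open>Expanding the Gauss-type sum by Moebius inversion restricts \<open>n\<close> to
  multiples of \<open>f\<close>. There the double conjugation restores \<open>chi (n div f)\<close>,
  which gives \<open>twisted_series Q f\<close>.\<close>

lemma H_series_eq:
  assumes Q: "Q > 0" "coprime Q N" and l: "l > 0" and s: "Re s > \<sigma>"
  shows "H_series A k chi Q l s = (\<Sum>(e, f) | e * f = l. gauss_sum k (conj_char chi) *
     (moebius_mu e * cnj (chi (int e)) * of_nat e powr (2 * s - 1) * of_nat f powr s * twisted_series Q f s))"
proof -
  define \<tau> where "\<tau> = gauss_sum k (conj_char chi)"
  define F where "F e f n = (moebius_mu e * cnj (chi (int e)) * of_nat f * \<tau> / of_nat l powr (1 - 2 * s)) *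
    (A Q n * (if f dvd n then chi (int (n div f)) else 0) * of_nat n powr (- s))" for e f n
  have "((\<lambda>n. \<Sum>p | fst p * snd p = l. F (fst p) (snd p) n) has_sum
      (\<Sum>p | fst p * snd p = l. \<tau> * (moebius_mu (fst p) * cnj (chi (int (fst p))) *
        of_nat (fst p) powr (2 * s - 1) * of_nat (snd p) powr s * twisted_series Q (snd p) s))) {1..}"
  proof (rule has_sum_finite_sum)
    show "finite {p. fst p * snd p = l}"
      using finite_factor_pairs[OF l] by (simp add: case_prod_unfold)
    fix p :: "nat \<times> nat" assume "p \<in> {p. fst p * snd p = l}"
    then obtain e f where p: "p = (e, f)" and ef: "l = e * f" by (cases p) auto
    with l have pos: "e > 0" "f > 0" by auto
    have "((\<lambda>n. F e f n) has_sum (moebius_mu e * cnj (chi (int e)) * of_nat f * \<tau> / of_nat l powr (1 - 2 * s)) *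
        (of_nat f powr (- s) * twisted_series Q f s)) {1..}"
      unfolding F_def by (intro has_sum_cmult_right has_sum_multiples Q s pos)
    \<comment> \<open>With \<open>l = e * f\<close>, the powers of \<open>f\<close> combine through
      \<open>1 + (2 * s - 1) - s = s\<close>.\<close>
    moreover have "of_nat f / of_nat l powr (1 - 2 * s) * of_nat f powr (- s) =
        of_nat e powr (2 * s - 1) * (of_nat f powr s :: complex)"
    proof -
      have "1 / of_nat l powr (1 - 2 * s) = (of_nat l powr (2 * s - 1) :: complex)"
        using powr_minus_divide[of "of_nat l :: complex" "1 - 2 * s"] by simp
      then have "of_nat f / of_nat l powr (1 - 2 * s) * of_nat f powr (- s) = of_nat e powr (2 * s - 1) *
          (of_nat f * of_nat f powr (2 * s - 1)) * (of_nat f powr (- s) :: complex)"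
        unfolding divide_inverse ef of_nat_mult_powr by simp
      also have "\<dots> = of_nat e powr (2 * s - 1) * of_nat f powr s"
        unfolding of_nat_mult_powr_double[OF pos(2)] using pos by (simp add: powr_minus)
      finally show ?thesis .
    qed
    then have "(moebius_mu e * cnj (chi (int e)) * of_nat f * \<tau> / of_nat l powr (1 - 2 * s)) *
        (of_nat f powr (- s) * twisted_series Q f s) = \<tau> * (moebius_mu e * cnj (chi (int e)) *
        of_nat e powr (2 * s - 1) * of_nat f powr s * twisted_series Q f s)"
      by (simp only: divide_inverse mult_ac) (simp add: mult_ac)
    ultimately show "((\<lambda>n. F (fst p) (snd p) n) has_sum \<tau> * (moebius_mu (fst p) * cnj (chi (int (fst p))) *
        of_nat (fst p) powr (2 * s - 1) * of_nat (snd p) powr s * twisted_series Q (snd p) s)) {1..}"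
      by (simp add: p)
  qed
  also have "(\<lambda>n. \<Sum>p | fst p * snd p = l. F (fst p) (snd p) n) = H_term A k chi Q l s"
  proof
    fix n
    show "(\<Sum>p | fst p * snd p = l. F (fst p) (snd p) n) = H_term A k chi Q l s n"
      unfolding H_term_def g_sum_primitive[OF primitive_character_conj_char[OF prim] l]
      by (simp add: F_def sum_distrib_left sum_distrib_right sum_divide_distrib case_prod_unfold
          divisor_gauss_def conj_char_def \<tau>_def powr_minus)
        (intro sum.cong, auto simp: field_simps conj_char_def)
  qed
  finally show ?thesis
    unfolding H_series_def \<tau>_def by (simp add: infsumI case_prod_unfold)
qed

text \<open>The factorisations \<open>d1 * e * f = m\<close> are regrouped with
  \<open>M = d1 * f\<close>. For fixed \<open>e\<close>, the sum over \<open>d2\<close> dividing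
  \<open>q\<close> and \<open>d1\<close> dividing \<open>M\<close> is the twisted Hecke relation for
  \<open>A q M\<close>.\<close>

lemma bold_H_eq:
  assumes q: "q > 0" "coprime q N" and m: "m > 0" "coprime m N" and s: "Re s > \<sigma>"
    and L: "((\<lambda>n. A 1 n * chi (int n) * of_nat n powr (- s)) has_sum L) {1..}"
  shows "bold_H \<psi> A k chi q m s = gauss_sum k (conj_char chi) * L * hecke_polynomial A chi q m s"
proof -
  define \<tau> where "\<tau> = gauss_sum k (conj_char chi)"
  define W where "W e = moebius_mu e * cnj (chi (int e)) * of_nat e powr (2 * s - 1)" for e
  define F where "F d2 d1 e f = \<tau> * \<psi> (int d2) * chi (int (d1 * d2)) / of_nat d2 powr s *
    W e * of_nat f powr s * twisted_series (q * d1 div d2) f s" for d2 d1 e f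
  have "bold_H \<psi> A k chi q m s =
      (\<Sum>d2 | d2 dvd q. \<Sum>(d1, l) | d1 * l = m. \<Sum>(e, f) | e * f = l. F d2 d1 e f)"
    unfolding bold_H_def bold_sum_def
  proof (rule sum.cong[OF refl], rule sum_factor_pairs_cong[OF m(1)])
    fix d2 d1 l assume d2: "d2 \<in> {d2. d2 dvd q}" and pos: "d1 > 0" "l > 0" and dl: "d1 * l = m"
    then obtain y where y: "q = d2 * y" by auto
    have "q * d1 div d2 = y * d1" using q(1) by (simp add: y mult.assoc)
    moreover have "y * d1 > 0" "coprime (y * d1) N" using q m dl pos unfolding y dl[symmetric] by auto
    ultimately have "H_series A k chi (q * d1 div d2) l s = (\<Sum>(e, f) | e * f = l. \<tau> *
        (W e * of_nat f powr s * twisted_series (q * d1 div d2) f s))"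
      using H_series_eq[of "y * d1" l s] pos s unfolding W_def \<tau>_def by simp
    then show "\<psi> (int d2) * chi (int (d1 * d2)) / of_nat d2 powr s * H_series A k chi (q * d1 div d2) l s =
        (\<Sum>(e, f) | e * f = l. F d2 d1 e f)"
      by (simp add: F_def sum_distrib_left case_prod_unfold mult_ac)
  qed
  also have "\<dots> = (\<Sum>d2 | d2 dvd q. \<Sum>(e, M) | e * M = m. \<Sum>(d1, f) | d1 * f = M. F d2 d1 e f)"
    by (intro sum.cong[OF refl] sum_factor_pairs_left_commute[OF m(1)])
  also have "\<dots> = (\<Sum>(e, M) | e * M = m. \<Sum>d2 | d2 dvd q. \<Sum>(d1, f) | d1 * f = M. F d2 d1 e f)"
    unfolding case_prod_unfold by (rule sum.swap)
  also have "\<dots> = (\<Sum>(e, M) | e * M = m. \<tau> * L * (W e * of_nat M powr s * A q M))"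
  proof (rule sum_factor_pairs_cong[OF m(1)])
    fix e M :: nat assume pos: "e > 0" "M > 0" and eM: "e * M = m"
    have "coprime M N" using m(2) by (simp add: eM[symmetric])
    then have "L * A q M = (\<Sum>b | b dvd M. \<Sum>c | c dvd q. \<psi> (int c) * chi (int (b * c)) *
        of_nat (b * c) powr (- s) * twisted_series (b * q div c) (M div b) s)"
      by (intro twisted_hecke_relation L pos q s)
    also have "\<dots> = (\<Sum>c | c dvd q. \<Sum>b | b dvd M. \<psi> (int c) * chi (int (b * c)) *
        of_nat (b * c) powr (- s) * twisted_series (b * q div c) (M div b) s)"
      by (rule sum.swap)
    finally have rel: "L * A q M = (\<Sum>c | c dvd q. \<Sum>b | b dvd M. \<psi> (int c) * chi (int (b * c)) *
        of_nat (b * c) powr (- s) * twisted_series (b * q div c) (M div b) s)" .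
    have "(\<Sum>d2 | d2 dvd q. \<Sum>(d1, f) | d1 * f = M. F d2 d1 e f) =
        (\<Sum>c | c dvd q. \<Sum>b | b dvd M. F c b e (M div b))"
      by (simp only: sum_factor_pairs[OF pos(2)])
    also have "\<dots> = (\<Sum>c | c dvd q. \<Sum>b | b dvd M. \<tau> * W e * of_nat M powr s *
        (\<psi> (int c) * chi (int (b * c)) * of_nat (b * c) powr (- s) * twisted_series (b * q div c) (M div b) s))"
    proof (intro sum.cong refl)
      fix c b assume "b \<in> {b. b dvd M}"
      then obtain f where f: "M = b * f" by auto
      with pos have b: "b > 0" by auto
      then have "M div b = f" by (simp add: f)
      \<comment> \<open>This supplies the missing power of \<open>b\<close> in the Hecke relation
        and leaves \<open>M\<close> as the only outer variable.\<close>
      moreover have "of_nat f powr s = of_nat M powr s * (of_nat b powr (- s) :: complex)"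
        unfolding f of_nat_mult_powr using b by (simp add: powr_minus)
      ultimately show "F c b e (M div b) = \<tau> * W e * of_nat M powr s *
        (\<psi> (int c) * chi (int (b * c)) * of_nat (b * c) powr (- s) * twisted_series (b * q div c) (M div b) s)"
        unfolding F_def of_nat_mult_powr by (simp add: powr_minus mult.commute[of q] field_simps)
    qed
    finally show "(\<Sum>d2 | d2 dvd q. \<Sum>(d1, f) | d1 * f = M. F d2 d1 e f) =
        \<tau> * L * (W e * of_nat M powr s * A q M)"
      unfolding sum_distrib_left[symmetric] rel[symmetric] by simp
  qed
  also have "\<dots> = \<tau> * L * hecke_polynomial A chi q m s"
    unfolding hecke_polynomial_def W_def by (simp add: sum_distrib_left case_prod_unfold)
  finally show ?thesis unfolding \<tau>_def .
qed

end

section \<open>The bold G reduced to a finite combination of dual twisted series\<close>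

text \<open>The factor \<open>k\<close> cancels from the divisibility condition. Hence the second
  modulus has the form \<open>r * k\<close>, as the Gauss sum identities require.\<close>

lemma g_index_eq:
  assumes "Q > 0" "k > (0::nat)"
  shows "{d. d * k dvd Q * (l * k)} = {d. d dvd Q * l}"
    and "d dvd Q * l \<Longrightarrow> Q * (l * k) div d = Q * l div d * k"
  using assms by (auto simp: mult.assoc[symmetric] dvd_div_mult)

text \<open>The dual side, where twist and nebentypus are conjugated and series are evaluated at
  \<open>1 - s\<close>.\<close>

locale G_setting = twisted_hecke N "\<lambda>c. cnj (\<psi> (int c))" "\<lambda>n. cnj (chi (int n))" At \<sigma>
  for N \<psi> chi At \<sigma> +
  fixes k :: nat
  assumes prim: "primitive_character k chi" and psi: "dirichlet_character N \<psi>"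
begin

lemmas chi = primitive_characterD[OF prim]

lemma k_pos: "k > 0"
  using chi dirichlet_character_pos by blast

lemma summable_row_g_sum:
  assumes "d > 0" "coprime d N" "Re (1 - s) > \<sigma>"
  shows "(\<lambda>n. At d n * of_nat n powr (- (1 - s)) * g_sum chi C n) summable_on {1..}"
  by (rule summable_on_bounded_weight[OF summable_row[OF assms]]) (rule norm_g_sum_le[OF chi])

text \<open>The inner sum over \<open>n\<close>, with \<open>r = Q * l div d\<close>. It depends on
  \<open>d1\<close> and \<open>l\<close> only through \<open>d1 * l = m\<close>, which is why the
  sum over factorisations of \<open>m\<close> can act on the other Gauss-type sum alone.\<close>

definition g_series :: "nat \<Rightarrow> nat \<Rightarrow> complex \<Rightarrow> complex" where
  "g_series d r s = (\<Sum>\<^sub>\<infinity>n\<in>{1..}. At d n * of_nat n powr (- (1 - s)) * g_sum chi (r * k) n)"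

lemma G_term_eq:
  assumes "d > 0" "Q > 0" "n > 0"
  shows "G_term At k chi Q l s d n = of_nat d powr (2 * s - 1) * of_nat Q powr (- s) * g_sum chi (l * k) d *
     (At d n * of_nat n powr (- (1 - s)) * g_sum chi (Q * (l * k) div d) n)"
proof -
  have n: "of_nat n powr s / of_nat n = (of_nat n powr (- (1 - s)) :: complex)"
    using assms by (simp add: powr_diff)
  have d: "of_nat d powr s * of_nat d powr s / of_nat d = (of_nat d powr (2 * s - 1) :: complex)"
    using assms of_nat_mult_powr_double[of d s] by (simp add: field_simps)
  have "G_term At k chi Q l s d n = (of_nat d powr s * of_nat d powr s / of_nat d) * of_nat Q powr (- s) *
     g_sum chi (l * k) d * (At d n * (of_nat n powr s / of_nat n) * g_sum chi (Q * (l * k) div d) n)"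
    unfolding G_term_def of_nat_divide_powr power2_eq_square of_nat_mult_powr
    using assms by (simp add: powr_minus field_simps)
  then show ?thesis unfolding n d .
qed

lemma G_term_summable:
  assumes "d > 0" "coprime d N" "Q > 0" "Re (1 - s) > \<sigma>"
  shows "G_term At k chi Q l s d summable_on {1..}"
proof -
  have "(\<lambda>n. of_nat d powr (2 * s - 1) * of_nat Q powr (- s) * g_sum chi (l * k) d *
     (At d n * of_nat n powr (- (1 - s)) * g_sum chi (Q * (l * k) div d) n)) summable_on {1..}"
    by (intro summable_on_cmult_right summable_row_g_sum assms)
  also have "?this \<longleftrightarrow> ?thesis"
    by (rule summable_on_cong) (use assms G_term_eq in simp)
  finally show ?thesis .
qed

lemma G_converges_coprime:
  assumes "Q > 0" "l > 0" "coprime Q N" "coprime l N" "Re (1 - s) > \<sigma>"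
  shows "G_converges At k chi Q l s"
  unfolding G_converges_def
proof (intro allI impI)
  fix d assume "d * k dvd Q * (l * k)"
  then have "d \<in> {d. d * k dvd Q * (l * k)}" by simp
  then have d: "d dvd Q * l" unfolding g_index_eq(1)[OF assms(1) k_pos] by simp
  have "coprime (Q * l) N" using assms by simp
  then have "coprime d N" by (rule coprime_divisors[OF d dvd_refl])
  moreover have "d > 0" using d assms by (auto intro!: Nat.gr0I)
  ultimately show "G_term At k chi Q l s d summable_on {1..}"
    using assms by (intro G_term_summable)
qed

lemma infsum_G_term:
  assumes "d dvd Q * l" "Q > 0" "l > 0"
  shows "(\<Sum>\<^sub>\<infinity>n\<in>{1..}. G_term At k chi Q l s d n) =
    of_nat d powr (2 * s - 1) * of_nat Q powr (- s) * g_sum chi (l * k) d * g_series d (Q * l div d) s"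
proof -
  have "d > 0" using assms by (auto intro!: Nat.gr0I)
  then have "(\<Sum>\<^sub>\<infinity>n\<in>{1..}. G_term At k chi Q l s d n) =
     (\<Sum>\<^sub>\<infinity>n\<in>{1..}. of_nat d powr (2 * s - 1) * of_nat Q powr (- s) * g_sum chi (l * k) d *
     (At d n * of_nat n powr (- (1 - s)) * g_sum chi (Q * l div d * k) n))"
    using assms G_term_eq[of d Q] by (intro infsum_cong) (simp add: g_index_eq(2)[OF _ k_pos])
  then show ?thesis unfolding g_series_def infsum_cmult_right' .
qed

text \<open>Under the sum over \<open>n\<close>, the factorisation identity keeps only multiples of
  \<open>R\<close>; its weight \<open>R\<close> turns the exponent \<open>s - 1\<close> into
  \<open>s\<close>.\<close>

lemma sum_g_series:
  assumes "d > 0" "coprime d N" "R > 0" "Re (1 - s) > \<sigma>"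
  shows "(\<Sum>(d2, r) | d2 * r = R. chi (int d2) * g_series d r s) =
    gauss_sum k chi * of_nat R powr s * twisted_series d R (1 - s)"
proof -
  have "((\<lambda>n. \<Sum>p | fst p * snd p = R. chi (int (fst p)) *
      (At d n * of_nat n powr (- (1 - s)) * g_sum chi (snd p * k) n)) has_sum
      (\<Sum>p | fst p * snd p = R. chi (int (fst p)) * g_series d (snd p) s)) {1..}"
    unfolding g_series_def
    using finite_factor_pairs[OF assms(3)]
    by (intro has_sum_finite_sum has_sum_cmult_right has_sum_infsum summable_row_g_sum assms)
      (simp add: case_prod_unfold)
  also have "(\<lambda>n. \<Sum>p | fst p * snd p = R. chi (int (fst p)) *
      (At d n * of_nat n powr (- (1 - s)) * g_sum chi (snd p * k) n)) =
      (\<lambda>n. gauss_sum k chi * of_nat R * (At d n * (if R dvd n then cnj (chi (int (n div R))) else 0) * of_nat n powr (- (1 - s))))"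
  proof
    fix n
    have "(\<Sum>p | fst p * snd p = R. chi (int (fst p)) *
      (At d n * of_nat n powr (- (1 - s)) * g_sum chi (snd p * k) n)) =
      At d n * of_nat n powr (- (1 - s)) * (\<Sum>(e, l) | e * l = R. chi (int e) * g_sum chi (l * k) n)"
      by (simp only: sum_distrib_left case_prod_unfold) (simp add: mult_ac)
    then show "(\<Sum>p | fst p * snd p = R. chi (int (fst p)) *
      (At d n * of_nat n powr (- (1 - s)) * g_sum chi (snd p * k) n)) =
      gauss_sum k chi * of_nat R * (At d n * (if R dvd n then cnj (chi (int (n div R))) else 0) * of_nat n powr (- (1 - s)))"
      unfolding sum_g_sum[OF prim assms(3)] by (simp add: divisor_gauss_def)
  qed
  finally have "((\<lambda>n. gauss_sum k chi * of_nat R * (At d n * (if R dvd n then cnj (chi (int (n div R))) else 0) *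
      of_nat n powr (- (1 - s)))) has_sum (\<Sum>(d2, r) | d2 * r = R. chi (int d2) * g_series d r s)) {1..}"
    by (simp only: case_prod_unfold)
  moreover have "((\<lambda>n. gauss_sum k chi * of_nat R * (At d n * (if R dvd n then cnj (chi (int (n div R))) else 0) *
      of_nat n powr (- (1 - s)))) has_sum gauss_sum k chi * of_nat R *
      (of_nat R powr (- (1 - s)) * twisted_series d R (1 - s))) {1..}"
    by (intro has_sum_cmult_right has_sum_multiples assms)
  ultimately have "(\<Sum>(d2, r) | d2 * r = R. chi (int d2) * g_series d r s) = gauss_sum k chi * of_nat R *
      (of_nat R powr (- (1 - s)) * twisted_series d R (1 - s))" by (rule has_sum_unique)
  moreover have "of_nat R * of_nat R powr (- (1 - s)) = (of_nat R powr s :: complex)"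
    using assms by (simp add: powr_diff)
  ultimately show ?thesis by (metis mult.assoc)
qed

text \<open>The meeting point of both sides: the collapsed bold G up to constants, and also the dual
  L-series times the Dirichlet polynomial.\<close>

definition dual_sum :: "nat \<Rightarrow> nat \<Rightarrow> complex \<Rightarrow> complex" where
  "dual_sum q m s = \<psi> (int (q * m)) * of_nat m powr s * (\<Sum>(d, R) | d * R = q.
     of_nat d powr (- (1 - s)) * cnj (chi (int d)) * twisted_series (m * d) R (1 - s))"

text \<open>The sums over \<open>e\<close> and over the divisors \<open>c\<close> of \<open>M\<close> in the Hecke relation for \<open>At M q\<close> merge into
  a sum of the Moebius function over \<open>e * c\<close>; only \<open>e * c = 1\<close> survives.\<close>

lemma dual_hecke_polynomial:
  assumes q: "q > 0" "coprime q N" and m: "m > 0" "coprime m N" and s: "Re (1 - s) > \<sigma>"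
    and L: "((\<lambda>n. At 1 n * cnj (chi (int n)) * of_nat n powr (- (1 - s))) has_sum L) {1..}"
  shows "L * hecke_polynomial (\<lambda>q M. \<psi> (int q) * \<psi> (int M) * At M q) chi q m s = dual_sum q m s"
proof -
  note psi_mult = dirichlet_character_mult[OF psi] and chi_mult = dirichlet_character_mult[OF chi]
  \<comment> \<open>One completely multiplicative weight absorbs the factors of both
    \<open>e\<close> and \<open>c\<close>, so that these two indices can merge.\<close>
  define h where "h j = cnj (chi (int j)) * of_nat j powr (2 * s - 1)" for j
  define V where "V b M' = \<psi> (int (q * M')) * of_nat M' powr s * cnj (chi (int b)) * of_nat b powr (- (1 - s)) *
    twisted_series (b * M') (q div b) (1 - s)" for b M'
  have "L * hecke_polynomial (\<lambda>q M. \<psi> (int q) * \<psi> (int M) * At M q) chi q m s =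
      (\<Sum>(e, M) | e * M = m. moebius_mu e * h e * of_nat M powr s * \<psi> (int (q * M)) * (L * At M q))"
    unfolding hecke_polynomial_def h_def
    by (simp add: sum_distrib_left case_prod_unfold psi_mult mult_ac)
  also have "\<dots> = (\<Sum>(e, M) | e * M = m. \<Sum>(c, M') | c * M' = M. moebius_mu e * h (e * c) * (\<Sum>b | b dvd q. V b M'))"
  proof (rule sum_factor_pairs_cong[OF m(1)])
    fix e M :: nat assume pos: "e > 0" "M > 0" and eM: "e * M = m"
    have M: "coprime M N" using m(2) by (simp add: eM[symmetric])
    have "L * At M q = (\<Sum>b | b dvd q. \<Sum>c | c dvd M. cnj (\<psi> (int c)) * cnj (chi (int (b * c))) *
        of_nat (b * c) powr (- (1 - s)) * twisted_series (b * M div c) (q div b) (1 - s))"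
      by (intro twisted_hecke_relation L pos q s M)
    also have "\<dots> = (\<Sum>b | b dvd q. \<Sum>(c, M') | c * M' = M. cnj (\<psi> (int c)) * cnj (chi (int (b * c))) *
        of_nat (b * c) powr (- (1 - s)) * twisted_series (b * M div c) (q div b) (1 - s))"
      by (simp only: sum_factor_pairs[OF pos(2)])
    also have "\<dots> = (\<Sum>(c, M') | c * M' = M. \<Sum>b | b dvd q. cnj (\<psi> (int c)) * cnj (chi (int (b * c))) *
        of_nat (b * c) powr (- (1 - s)) * twisted_series (b * M div c) (q div b) (1 - s))"
      unfolding case_prod_unfold by (rule sum.swap)
    finally have "moebius_mu e * h e * of_nat M powr s * \<psi> (int (q * M)) * (L * At M q) =
       (\<Sum>(c, M') | c * M' = M. moebius_mu e * h e * of_nat M powr s * \<psi> (int (q * M)) *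
       (\<Sum>b | b dvd q. cnj (\<psi> (int c)) * cnj (chi (int (b * c))) *
        of_nat (b * c) powr (- (1 - s)) * twisted_series (b * M div c) (q div b) (1 - s)))"
      by (simp only: sum_distrib_left case_prod_unfold)
    also have "\<dots> = (\<Sum>(c, M') | c * M' = M. moebius_mu e * h (e * c) * (\<Sum>b | b dvd q. V b M'))"
    proof (rule sum_factor_pairs_cong[OF pos(2)])
      fix c M' :: nat assume c: "c > 0" "M' > 0" and cM: "c * M' = M"
      have "coprime (int c) (int N)" using M by (simp add: cM[symmetric])
      \<comment> \<open>Since \<open>c\<close> divides \<open>m\<close>, it is coprime to
        \<open>N\<close>; the conjugate nebentypus of the dual relation cancels against
        \<open>\<psi> (int M)\<close>.\<close>
      then have unit: "\<psi> (int c) * cnj (\<psi> (int c)) = 1" by (rule dirichlet_character_mult_cnj[OF psi])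
      \<comment> \<open>The exponent \<open>s\<close> from the power of \<open>M\<close> and
        \<open>s - 1\<close> from the Hecke relation add up to the exponent that \<open>e\<close>
        carries.\<close>
      have pw: "of_nat c powr s * of_nat c powr (- (1 - s)) = (of_nat c powr (2 * s - 1) :: complex)"
        by (simp flip: powr_add)
      have div: "b * M div c = b * M'" for b using c by (simp add: cM[symmetric])
      have "of_nat M powr s * \<psi> (int (q * M)) * (cnj (\<psi> (int c)) * cnj (chi (int (b * c))) *
        of_nat (b * c) powr (- (1 - s)) * twisted_series (b * M div c) (q div b) (1 - s)) =
        (\<psi> (int c) * cnj (\<psi> (int c))) * cnj (chi (int c)) * (of_nat c powr s * of_nat c powr (- (1 - s))) * V b M'" for b
        unfolding div V_def unfolding cM[symmetric] of_nat_mult_powr by (simp add: psi_mult chi_mult mult_ac)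
      then have "of_nat M powr s * \<psi> (int (q * M)) * (\<Sum>b | b dvd q. cnj (\<psi> (int c)) * cnj (chi (int (b * c))) *
        of_nat (b * c) powr (- (1 - s)) * twisted_series (b * M div c) (q div b) (1 - s)) =
        h c * (\<Sum>b | b dvd q. V b M')"
        unfolding sum_distrib_left unit pw h_def by simp
      moreover have "h (e * c) = h e * h c"
        unfolding h_def of_nat_mult_powr by (simp add: chi_mult mult_ac)
      ultimately show "moebius_mu e * h e * of_nat M powr s * \<psi> (int (q * M)) *
       (\<Sum>b | b dvd q. cnj (\<psi> (int c)) * cnj (chi (int (b * c))) *
        of_nat (b * c) powr (- (1 - s)) * twisted_series (b * M div c) (q div b) (1 - s)) =
        moebius_mu e * h (e * c) * (\<Sum>b | b dvd q. V b M')"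
        by (simp add: mult.assoc)
    qed
    finally show "moebius_mu e * h e * of_nat M powr s * \<psi> (int (q * M)) * (L * At M q) =
      (\<Sum>(c, M') | c * M' = M. moebius_mu e * h (e * c) * (\<Sum>b | b dvd q. V b M'))" .
  qed
  also have "\<dots> = (\<Sum>(x, M') | x * M' = m. \<Sum>(e, c) | e * c = x. moebius_mu e * h (e * c) * (\<Sum>b | b dvd q. V b M'))"
    by (rule sum_factor_pairs_assoc[OF m(1)])
  also have "\<dots> = (\<Sum>(x, M') | x * M' = m. if x = 1 then (\<Sum>b | b dvd q. V b M') else 0)"
  proof (rule sum_factor_pairs_cong[OF m(1)])
    fix x M' :: nat assume "x > 0"
    from sum_factor_pairs_moebius[OF this, of h]
    have "(\<Sum>(e, c) | e * c = x. moebius_mu e * h (e * c) * (\<Sum>b | b dvd q. V b M')) =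
        (if x = 1 then h 1 else 0) * (\<Sum>b | b dvd q. V b M')"
      unfolding case_prod_unfold sum_distrib_right[symmetric] by simp
    moreover have "h 1 = 1" by (simp add: h_def dirichlet_character_one[OF chi])
    ultimately show "(\<Sum>(e, c) | e * c = x. moebius_mu e * h (e * c) * (\<Sum>b | b dvd q. V b M')) =
        (if x = 1 then (\<Sum>b | b dvd q. V b M') else 0)" by simp
  qed
  also have "\<dots> = (\<Sum>b | b dvd q. V b m)"
    using m(1) by (simp add: sum_factor_pairs sum.If_cases if_distrib cong: if_cong)
  also have "\<dots> = dual_sum q m s"
    unfolding dual_sum_def sum_factor_pairs[OF q(1)] V_def
    by (simp add: sum_distrib_left mult_ac)
  finally show ?thesis .
qed

text \<open>Two collapses, each producing one Gauss sum. Summing over \<open>d1 * l = m\<close>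
  forces \<open>d\<close> to be a multiple of \<open>m\<close>; summing over \<open>d2\<close>, once
  \<open>q\<close> is written as a product of \<open>d2\<close> and two further factors, turns each
  \<open>g_series\<close> into a \<open>twisted_series\<close>.\<close>

lemma bold_G_eq:
  assumes q: "q > 0" "coprime q N" and m: "m > 0" "coprime m N" and s: "Re (1 - s) > \<sigma>"
  shows "bold_G N \<psi> Gp Gm At k chi q m s =
    chi (- int N) * \<psi> (int k) * by_parity chi Gp Gm s * of_nat k powr (1 - 3 * s) * gauss_sum k chi ^ 2 *
    dual_sum q m s"
proof -
  note psi_mult = dirichlet_character_mult[OF psi] and chi_mult = dirichlet_character_mult[OF chi]
  define K where "K = chi (- int N) * \<psi> (int k) * by_parity chi Gp Gm s * of_nat k powr (1 - 3 * s)"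
  define K1 where "K1 = K * \<psi> (int (q * m)) * of_nat (q * m) powr (- s)"
  define \<tau> where "\<tau> = gauss_sum k chi"
  have "bold_G N \<psi> Gp Gm At k chi q m s = (\<Sum>d2 | d2 dvd q. \<Sum>(d1, l) | d1 * l = m.
      K1 * chi (int d2) * (\<Sum>d | d dvd q div d2 * m. of_nat d powr (2 * s - 1) * g_series d (q div d2 * m div d) s *
        (chi (int d1) * g_sum chi (l * k) d)))"
    unfolding bold_G_def bold_sum_def
  proof (rule sum.cong[OF refl], rule sum_factor_pairs_cong[OF m(1)])
    fix d2 d1 l assume d2: "d2 \<in> {d2. d2 dvd q}" and pos: "d1 > 0" "l > 0" and dl: "d1 * l = m"
    then obtain y where y: "q = d2 * y" by auto
    have d2_pos: "d2 > 0" and y_pos: "y > 0" using q(1) y by auto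
    have qd: "q div d2 = y" and Q: "q * d1 div d2 = y * d1" using d2_pos by (simp_all add: y mult.assoc)
    have Ql: "y * d1 * l = y * m" by (simp add: dl[symmetric] mult.assoc)
    have Qp: "y * d1 > 0" using pos y_pos by simp
    have "G_series N \<psi> Gp Gm At k chi (y * d1) l s =
        chi (- int N) * \<psi> (int (y * d1 * (l * k))) * by_parity chi Gp Gm s /
       (of_nat (l * k) powr (3 * s - 1) * of_nat l powr (1 - 2 * s)) *
       (\<Sum>d | d dvd y * m. of_nat d powr (2 * s - 1) * of_nat (y * d1) powr (- s) * g_sum chi (l * k) d *
          g_series d (y * m div d) s)"
      unfolding G_series_def g_index_eq(1)[OF Qp k_pos]
      by (simp only: Ql) (intro arg_cong2[where f = "(*)"] refl sum.cong,
        use infsum_G_term[OF _ Qp pos(2)] in \<open>simp add: Ql\<close>)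
    also have "(\<Sum>d | d dvd y * m. of_nat d powr (2 * s - 1) * of_nat (y * d1) powr (- s) * g_sum chi (l * k) d *
          g_series d (y * m div d) s) = of_nat (y * d1) powr (- s) *
          (\<Sum>d | d dvd y * m. of_nat d powr (2 * s - 1) * g_series d (y * m div d) s * g_sum chi (l * k) d)"
      by (simp only: sum_distrib_left) (simp add: mult_ac)
    also have "\<psi> (int (y * d1 * (l * k))) = \<psi> (int (y * m)) * \<psi> (int k)"
      by (simp add: dl[symmetric] psi_mult)
    finally have G: "G_series N \<psi> Gp Gm At k chi (y * d1) l s =
        chi (- int N) * (\<psi> (int (y * m)) * \<psi> (int k)) * by_parity chi Gp Gm s /
       (of_nat (l * k) powr (3 * s - 1) * of_nat l powr (1 - 2 * s)) * (of_nat (y * d1) powr (- s) *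
          (\<Sum>d | d dvd y * m. of_nat d powr (2 * s - 1) * g_series d (y * m div d) s * g_sum chi (l * k) d))" .
    \<comment> \<open>The powers of \<open>l\<close> in the denominator leave \<open>l\<close> to
      the power \<open>s\<close>. Together with \<open>d2\<close> and \<open>y * d1\<close> this
      forms the single factor \<open>q * m\<close> to the power \<open>-s\<close> in
      \<open>K1\<close>.\<close>
    have l: "of_nat l powr (3 * s - 1) * of_nat l powr (1 - 2 * s) = (of_nat l powr s :: complex)"
      by (simp flip: powr_add)
    have k: "of_nat k powr (1 - 3 * s) = inverse (of_nat k powr (3 * s - 1) :: complex)"
      using powr_minus[of "of_nat k :: complex" "3 * s - 1"] by simp
    have "of_nat (l * k) powr (3 * s - 1) * of_nat l powr (1 - 2 * s) =
        of_nat k powr (3 * s - 1) * (of_nat l powr s :: complex)"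
      unfolding of_nat_mult_powr l[symmetric] by simp
    moreover have "of_nat (q * m) powr (- s) = inverse (of_nat d2 powr s) * inverse (of_nat l powr s) * (of_nat (y * d1) powr (- s) :: complex)"
      unfolding y dl[symmetric] of_nat_mult_powr by (simp add: powr_minus)
    moreover have "\<psi> (int (q * m)) = \<psi> (int d2) * \<psi> (int (y * m))" by (simp add: y psi_mult)
    ultimately have "\<psi> (int d2) * chi (int (d1 * d2)) / of_nat d2 powr s * G_series N \<psi> Gp Gm At k chi (y * d1) l s =
        K1 * chi (int d2) * (chi (int d1) *
        (\<Sum>d | d dvd y * m. of_nat d powr (2 * s - 1) * g_series d (y * m div d) s * g_sum chi (l * k) d))"
      unfolding G K1_def K_def k by (simp add: divide_inverse chi_mult mult_ac)
    then show "\<psi> (int d2) * chi (int (d1 * d2)) / of_nat d2 powr s * G_series N \<psi> Gp Gm At k chi (q * d1 div d2) l s =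
        K1 * chi (int d2) * (\<Sum>d | d dvd q div d2 * m. of_nat d powr (2 * s - 1) * g_series d (q div d2 * m div d) s *
        (chi (int d1) * g_sum chi (l * k) d))"
      unfolding Q qd by (simp add: sum_distrib_left mult_ac)
  qed
  also have "\<dots> = (\<Sum>d2 | d2 dvd q. K1 * chi (int d2) * (\<Sum>d | d dvd q div d2 * m. of_nat d powr (2 * s - 1) *
      g_series d (q div d2 * m div d) s * divisor_gauss k chi m d))"
  proof (rule sum.cong[OF refl])
    fix d2
    have "(\<Sum>(d1, l) | d1 * l = m.
      K1 * chi (int d2) * (\<Sum>d | d dvd q div d2 * m. of_nat d powr (2 * s - 1) * g_series d (q div d2 * m div d) s *
        (chi (int d1) * g_sum chi (l * k) d))) = K1 * chi (int d2) * (\<Sum>d | d dvd q div d2 * m. of_nat d powr (2 * s - 1) *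
      g_series d (q div d2 * m div d) s * (\<Sum>(d1, l) | d1 * l = m. chi (int d1) * g_sum chi (l * k) d))"
      unfolding case_prod_unfold sum_distrib_left[symmetric] by (subst sum.swap) (simp only: sum_distrib_left)
    then show "(\<Sum>(d1, l) | d1 * l = m.
      K1 * chi (int d2) * (\<Sum>d | d dvd q div d2 * m. of_nat d powr (2 * s - 1) * g_series d (q div d2 * m div d) s *
        (chi (int d1) * g_sum chi (l * k) d))) = K1 * chi (int d2) * (\<Sum>d | d dvd q div d2 * m. of_nat d powr (2 * s - 1) *
      g_series d (q div d2 * m div d) s * divisor_gauss k chi m d)"
      unfolding sum_g_sum[OF prim m(1)] .
  qed
  also have "\<dots> = (\<Sum>(d2, y) | d2 * y = q. K1 * chi (int d2) * (\<Sum>d | d dvd y * m. of_nat d powr (2 * s - 1) *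
      g_series d (y * m div d) s * divisor_gauss k chi m d))"
    by (simp only: sum_factor_pairs[OF q(1)])
  also have "\<dots> = (\<Sum>(d2, y) | d2 * y = q. \<Sum>(d, r) | d * r = y. K1 * \<tau> * of_nat m * of_nat (m * d) powr (2 * s - 1) *
      cnj (chi (int d)) * (chi (int d2) * g_series (m * d) r s))"
  proof (rule sum_factor_pairs_cong[OF q(1)])
    fix d2 y :: nat assume y: "y > 0"
    define f where "f d = of_nat d powr (2 * s - 1) * g_series d (y * m div d) s * divisor_gauss k chi m d" for d
    \<comment> \<open>\<open>divisor_gauss\<close> vanishes off multiples of \<open>m\<close>, so
      \<open>d\<close> is replaced by \<open>m * d\<close> with the new \<open>d\<close> dividing
      \<open>y\<close>.\<close>
    have "(\<Sum>d | d dvd y * m. f d) = (\<Sum>d\<in>(*) m ` {d. d dvd y}. f d)"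
    proof (rule sum.mono_neutral_right)
      show "\<forall>d\<in>{d. d dvd y * m} - (*) m ` {d. d dvd y}. f d = 0"
      proof
        fix d assume d: "d \<in> {d. d dvd y * m} - (*) m ` {d. d dvd y}"
        have "\<not> m dvd d"
        proof
          assume "m dvd d"
          then obtain x where "d = m * x" by auto
          then show False using d m(1) by (auto simp: mult.commute)
        qed
        then show "f d = 0" by (simp add: f_def divisor_gauss_def)
      qed
    qed (use y m(1) in \<open>auto simp: mult.commute\<close>)
    also have "\<dots> = (\<Sum>d | d dvd y. f (m * d))"
      using m(1) by (subst sum.reindex) (auto simp: inj_on_def)
    also have "\<dots> = (\<Sum>d | d dvd y. \<tau> * of_nat m * of_nat (m * d) powr (2 * s - 1) *
      cnj (chi (int d)) * g_series (m * d) (y div d) s)"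
    proof (rule sum.cong[OF refl])
      fix d
      have "y * m div (m * d) = y div d" using m(1) by (simp add: mult.commute)
      then show "f (m * d) = \<tau> * of_nat m * of_nat (m * d) powr (2 * s - 1) *
        cnj (chi (int d)) * g_series (m * d) (y div d) s"
        unfolding f_def using m(1) by (simp add: divisor_gauss_def \<tau>_def mult_ac)
    qed
    finally have "(\<Sum>d | d dvd y * m. f d) = (\<Sum>d | d dvd y. \<tau> * of_nat m * of_nat (m * d) powr (2 * s - 1) *
      cnj (chi (int d)) * g_series (m * d) (y div d) s)" .
    then show "K1 * chi (int d2) * (\<Sum>d | d dvd y * m. of_nat d powr (2 * s - 1) *
      g_series d (y * m div d) s * divisor_gauss k chi m d) = (\<Sum>(d, r) | d * r = y. K1 * \<tau> * of_nat m *
      of_nat (m * d) powr (2 * s - 1) * cnj (chi (int d)) * (chi (int d2) * g_series (m * d) r s))"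
      unfolding f_def sum_factor_pairs[OF y] by (simp only: sum_distrib_left) (simp add: mult_ac)
  qed
  \<comment> \<open>In \<open>q = d2 * d * r\<close> the factor \<open>d\<close> moves outside; the
    remaining sum over \<open>d2 * r = R\<close> is ready for the second collapse.\<close>
  also have "\<dots> = (\<Sum>(d, R) | d * R = q. \<Sum>(d2, r) | d2 * r = R. K1 * \<tau> * of_nat m * of_nat (m * d) powr (2 * s - 1) *
      cnj (chi (int d)) * (chi (int d2) * g_series (m * d) r s))"
    by (rule sum_factor_pairs_left_commute[OF q(1)])
  also have "\<dots> = (\<Sum>(d, R) | d * R = q. K * \<tau> ^ 2 * (\<psi> (int (q * m)) * of_nat m powr s *
      (of_nat d powr (- (1 - s)) * cnj (chi (int d)) * twisted_series (m * d) R (1 - s))))"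
  proof (rule sum_factor_pairs_cong[OF q(1)])
    fix d R :: nat assume pos: "d > 0" "R > 0" and dR: "d * R = q"
    have cop: "coprime (m * d) N" "m * d > 0" using q(2) m pos unfolding dR[symmetric] by auto
    have "(\<Sum>(d2, r) | d2 * r = R. K1 * \<tau> * of_nat m * of_nat (m * d) powr (2 * s - 1) *
      cnj (chi (int d)) * (chi (int d2) * g_series (m * d) r s)) =
      K1 * \<tau> * of_nat m * of_nat (m * d) powr (2 * s - 1) * cnj (chi (int d)) *
      (\<Sum>(d2, r) | d2 * r = R. chi (int d2) * g_series (m * d) r s)"
      by (simp only: sum_distrib_left case_prod_unfold)
    also have "\<dots> = K1 * \<tau> * of_nat m * of_nat (m * d) powr (2 * s - 1) * cnj (chi (int d)) *
      (\<tau> * of_nat R powr s * twisted_series (m * d) R (1 - s))"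
      unfolding \<tau>_def sum_g_series[OF cop(2,1) pos(2) s] ..
    also have "\<dots> = K * \<tau> ^ 2 * (\<psi> (int (q * m)) * (of_nat (q * m) powr (- s) *
        (of_nat m * of_nat (m * d) powr (2 * s - 1) * of_nat R powr s)) *
        (cnj (chi (int d)) * twisted_series (m * d) R (1 - s)))"
      unfolding K1_def power2_eq_square by (simp only: mult_ac)
    \<comment> \<open>With \<open>q = d * R\<close>, the powers of \<open>R\<close> cancel, those of
      \<open>m\<close> total \<open>s\<close>, and those of \<open>d\<close> total
      \<open>s - 1\<close>.\<close>
    also have "of_nat (q * m) powr (- s) * (of_nat m * of_nat (m * d) powr (2 * s - 1) * of_nat R powr s) =
        of_nat m powr s * (of_nat d powr (- (1 - s)) :: complex)"
    proof -
      have dd: "of_nat d powr (- s) * of_nat d powr (2 * s - 1) = (of_nat d powr (- (1 - s)) :: complex)"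
        by (simp flip: powr_add)
      have RR: "of_nat R powr (- s) * of_nat R powr s = (1 :: complex)"
        using pos by (simp flip: powr_add)
      have mm: "of_nat m powr (- s) * of_nat m powr s = (1 :: complex)"
        using m by (simp flip: powr_add)
      have "of_nat (q * m) powr (- s) * (of_nat m * of_nat (m * d) powr (2 * s - 1) * of_nat R powr s) =
          (of_nat d powr (- s) * of_nat d powr (2 * s - 1)) * (of_nat R powr (- s) * of_nat R powr s) *
          (of_nat m powr (- s) * (of_nat m * of_nat m powr (2 * s - 1)) :: complex)"
        unfolding dR[symmetric] of_nat_mult_powr by (simp only: mult_ac)
      also have "\<dots> = of_nat d powr (- (1 - s)) * ((of_nat m powr (- s) * of_nat m powr s) * of_nat m powr s)"
        unfolding dd RR of_nat_mult_powr_double[OF m(1)] by (simp only: mult_ac mult_1_left)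
      finally show ?thesis unfolding mm by (simp add: mult.commute)
    qed
    finally show "(\<Sum>(d2, r) | d2 * r = R. K1 * \<tau> * of_nat m * of_nat (m * d) powr (2 * s - 1) *
      cnj (chi (int d)) * (chi (int d2) * g_series (m * d) r s)) = K * \<tau> ^ 2 * (\<psi> (int (q * m)) * of_nat m powr s *
      (of_nat d powr (- (1 - s)) * cnj (chi (int d)) * twisted_series (m * d) R (1 - s)))"
      by (simp only: mult_ac)
  qed
  also have "\<dots> = K * \<tau> ^ 2 * dual_sum q m s"
    unfolding dual_sum_def by (simp only: sum_distrib_left case_prod_unfold)
  finally show ?thesis unfolding K_def \<tau>_def .
qed

end

section \<open>Entire continuation and equality through the functional equation\<close>

theorem theorem4p3:
  fixes N :: nat and \<psi> :: "int \<Rightarrow> complex"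
    and A At :: "nat \<Rightarrow> nat \<Rightarrow> complex"
    and Gp Gm :: "complex \<Rightarrow> complex" and Dp Dm :: "complex set"
    and k q m :: nat and chi :: "int \<Rightarrow> complex"
  assumes "N \<ge> 1" and "dirichlet_character N \<psi>"
    and dual: "\<And>i j. i > 0 \<Longrightarrow> j > 0 \<Longrightarrow> coprime (i * j) N \<Longrightarrow>
           A i j = \<psi> (int i) * \<psi> (int j) * At j i"
    and hecke: "\<And>r n1 n2. r > 0 \<Longrightarrow> n1 > 0 \<Longrightarrow> n2 > 0 \<Longrightarrow> coprime (n1 * n2) N \<Longrightarrow>
           A 1 r * A n2 n1 =
           (\<Sum>(a, b, c) | a * b * c = r \<and> b dvd n1 \<and> c dvd n2.
              A (b * n2 div c) (a * n1 div b) * \<psi> (int c))"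
    and hecke_dual: "\<And>r n1 n2. r > 0 \<Longrightarrow> n1 > 0 \<Longrightarrow> n2 > 0 \<Longrightarrow> coprime (n1 * n2) N \<Longrightarrow>
           At 1 r * At n2 n1 =
           (\<Sum>(a, b, c) | a * b * c = r \<and> b dvd n1 \<and> c dvd n2.
              At (b * n2 div c) (a * n1 div b) * conj_char \<psi> (int c))"
    \<comment> \<open>\<open>Dp\<close> and \<open>Dm\<close> are the domains of \<open>Gp\<close> and \<open>Gm\<close>, which may have poles elsewhere.\<close>
    and domain: "\<exists>\<sigma>::real. \<forall>s. Re (1 - s) > \<sigma> \<longrightarrow> s \<in> Dp \<inter> Dm"
    and functional_equation: "\<And>c' chi'. primitive_character c' chi' \<Longrightarrow> coprime c' N \<Longrightarrow>
           \<exists>L Lt. entire_L_function (\<lambda>n. A 1 n * chi' (int n)) L \<and>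
             entire_L_function (\<lambda>n. At 1 n * conj_char chi' (int n)) Lt \<and>
             (\<forall>s \<in> by_parity chi' Dp Dm.
                L s = by_parity chi' Gp Gm s * \<psi> (int c') * chi' (int N) *
                  of_nat c' powr (- 3 * s) * gauss_sum c' chi' ^ 3 * Lt (1 - s))"
    and "primitive_character k chi" and "coprime k N"
    and "q > 0" and "m > 0" and "coprime q N" and "coprime m N"
  shows "\<exists>Hc Gc. Hc holomorphic_on UNIV \<and> Gc holomorphic_on UNIV \<and>
      (\<exists>\<sigma>::real. \<forall>s. Re s > \<sigma> \<longrightarrow>
         (\<forall>d2 d1 l. d2 dvd q \<and> d1 * l = m \<longrightarrow> H_converges A k chi (q * d1 div d2) l s) \<and>
         Hc s = bold_H \<psi> A k chi q m s) \<and>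
      (\<exists>\<sigma>::real. \<forall>s. Re (1 - s) > \<sigma> \<longrightarrow>
         (\<forall>d2 d1 l. d2 dvd q \<and> d1 * l = m \<longrightarrow> G_converges At k chi (q * d1 div d2) l s) \<and>
         Gc s = bold_G N \<psi> Gp Gm At k chi q m s) \<and>
      (\<forall>s. Hc s = Gc s)"
proof -
  note psi = assms(2) and prim = \<open>primitive_character k chi\<close>
  note chi = primitive_characterD[OF prim]
  have kpos: "k > 0" using chi dirichlet_character_pos by blast
  have dual_row: "A q M = \<psi> (int q) * \<psi> (int M) * At M q" if "M > 0" "coprime M N" for M
    using that \<open>q > 0\<close> \<open>coprime q N\<close> by (intro dual) simp_all
  obtain \<sigma>0 :: real where dom: "\<And>s. Re (1 - s) > \<sigma>0 \<Longrightarrow> s \<in> Dp \<inter> Dm" using domain by blast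
  \<comment> \<open>The modulus 1 is coprime to \<open>N\<close>, so the trivial character provides
    absolute convergence of both untwisted first rows.\<close>
  obtain L1 Lt1 where L1: "entire_L_function (\<lambda>n. A 1 n * (\<lambda>_. 1) (int n)) L1"
      and Lt1: "entire_L_function (\<lambda>n. At 1 n * conj_char (\<lambda>_. 1) (int n)) Lt1"
    using functional_equation[OF primitive_character_trivial] by auto
  from L1 obtain \<sigma>1 :: real where
      "\<And>s. Re s > \<sigma>1 \<Longrightarrow> ((\<lambda>n. A 1 n * of_nat n powr (- s)) has_sum L1 s) {1..}"
    unfolding entire_L_function_def by auto
  then have row: "\<And>s. Re s > \<sigma>1 \<Longrightarrow> (\<lambda>n. A 1 n * of_nat n powr (- s)) summable_on {1..}"
    by (meson has_sum_imp_summable)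
  from Lt1 obtain \<sigma>2 :: real where
      "\<And>s. Re s > \<sigma>2 \<Longrightarrow> ((\<lambda>n. At 1 n * of_nat n powr (- s)) has_sum Lt1 s) {1..}"
    unfolding entire_L_function_def conj_char_def by auto
  then have rowt: "\<And>s. Re s > \<sigma>2 \<Longrightarrow> (\<lambda>n. At 1 n * of_nat n powr (- s)) summable_on {1..}"
    by (meson has_sum_imp_summable)
  obtain L Lt where L: "entire_L_function (\<lambda>n. A 1 n * chi (int n)) L"
      and Lt: "entire_L_function (\<lambda>n. At 1 n * conj_char chi (int n)) Lt"
      and FE: "\<And>s. s \<in> by_parity chi Dp Dm \<Longrightarrow>
                L s = by_parity chi Gp Gm s * \<psi> (int k) * chi (int N) *
                  of_nat k powr (- 3 * s) * gauss_sum k chi ^ 3 * Lt (1 - s)"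
    using functional_equation[OF prim \<open>coprime k N\<close>] by blast
  obtain \<sigma>3 :: real where L_sum:
      "\<And>s. Re s > \<sigma>3 \<Longrightarrow> ((\<lambda>n. A 1 n * chi (int n) * of_nat n powr (- s)) has_sum L s) {1..}"
    using L unfolding entire_L_function_def by auto
  obtain \<sigma>4 :: real where Lt_sum:
      "\<And>s. Re s > \<sigma>4 \<Longrightarrow> ((\<lambda>n. At 1 n * cnj (chi (int n)) * of_nat n powr (- s)) has_sum Lt s) {1..}"
    using Lt unfolding entire_L_function_def conj_char_def by auto

  interpret H: H_setting N \<psi> chi A \<sigma>1 k
  proof unfold_locales
    show "\<psi> (int 1) = 1" using dirichlet_character_one[OF psi] by simp
    show "chi (int (a * b)) = chi (int a) * chi (int b)" for a b
      by (simp add: dirichlet_character_mult[OF chi])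
  qed (use hecke row prim norm_dirichlet_character_le[OF chi] in blast)+
  interpret G: G_setting N \<psi> chi At \<sigma>2 k
  proof unfold_locales
    show "cnj (\<psi> (int 1)) = 1" using dirichlet_character_one[OF psi] by simp
    show "cnj (chi (int (a * b))) = cnj (chi (int a)) * cnj (chi (int b))" for a b
      by (simp add: dirichlet_character_mult[OF chi])
    show "norm (cnj (chi (int a))) \<le> 1" for a
      using norm_dirichlet_character_le[OF chi] by simp
  qed (use hecke_dual[unfolded conj_char_def] rowt prim psi in blast)+

  \<comment> \<open>This one entire function serves as both continuations; it remains to match it
    with the bold H for large \<open>Re s\<close> and with the bold G for large
    \<open>Re (1 - s)\<close>.\<close>
  define Hc where "Hc s = gauss_sum k (conj_char chi) * L s * hecke_polynomial A chi q m s" for s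
  have "L holomorphic_on UNIV" using L unfolding entire_L_function_def by blast
  then have hol: "Hc holomorphic_on UNIV"
    unfolding Hc_def[abs_def] by (intro holomorphic_intros holomorphic_hecke_polynomial)

  \<comment> \<open>All indices occurring in the two sums stay positive and coprime to
    \<open>N\<close>, as the convergence of the rows requires.\<close>
  have side: "q * d1 div d2 > 0 \<and> l > 0 \<and> coprime (q * d1 div d2) N \<and> coprime l N"
    if d2: "d2 dvd q" and dl: "d1 * l = m" for d2 d1 l
  proof -
    obtain y where y: "q = d2 * y" using d2 by blast
    then have "d2 > 0" using \<open>q > 0\<close> by simp
    then have "q * d1 div d2 = y * d1" by (simp add: y mult.assoc)
    then show ?thesis
      using \<open>q > 0\<close> \<open>m > 0\<close> \<open>coprime q N\<close> \<open>coprime m N\<close> unfolding dl[symmetric] y by simp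
  qed

  have Hc_H: "(\<forall>d2 d1 l. d2 dvd q \<and> d1 * l = m \<longrightarrow> H_converges A k chi (q * d1 div d2) l s) \<and>
         Hc s = bold_H \<psi> A k chi q m s" if "Re s > max \<sigma>1 \<sigma>3" for s
  proof (intro conjI allI impI)
    fix d2 d1 l assume "d2 dvd q \<and> d1 * l = m"
    then show "H_converges A k chi (q * d1 div d2) l s"
      using that side by (intro H.H_converges_coprime) auto
  next
    show "Hc s = bold_H \<psi> A k chi q m s"
      unfolding Hc_def using that
      by (intro H.bold_H_eq[symmetric] L_sum \<open>q > 0\<close> \<open>m > 0\<close> \<open>coprime q N\<close> \<open>coprime m N\<close>) auto
  qed

  have Hc_G: "(\<forall>d2 d1 l. d2 dvd q \<and> d1 * l = m \<longrightarrow> G_converges At k chi (q * d1 div d2) l s) \<and>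
         Hc s = bold_G N \<psi> Gp Gm At k chi q m s" if s: "Re (1 - s) > max \<sigma>0 (max \<sigma>2 \<sigma>4)" for s
  proof (intro conjI allI impI)
    fix d2 d1 l assume "d2 dvd q \<and> d1 * l = m"
    then show "G_converges At k chi (q * d1 div d2) l s"
      using s side by (intro G.G_converges_coprime) auto
  next
    have s2: "Re (1 - s) > \<sigma>2" and s4: "Re (1 - s) > \<sigma>4" and s0: "Re (1 - s) > \<sigma>0" using s by simp_all
    \<comment> \<open>Only entries \<open>A q M\<close> with \<open>M\<close> dividing
      \<open>m\<close> occur, and for these the duality between \<open>A\<close> and
      \<open>At\<close> applies.\<close>
    have "hecke_polynomial A chi q m s =
        hecke_polynomial (\<lambda>q M. \<psi> (int q) * \<psi> (int M) * At M q) chi q m s"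
      unfolding hecke_polynomial_def
    proof (rule sum_factor_pairs_cong[OF \<open>m > 0\<close>])
      fix e M :: nat assume "M > 0" and eM: "e * M = m"
      moreover have "coprime M N" using \<open>coprime m N\<close> by (simp add: eM[symmetric])
      ultimately show "moebius_mu e * cnj (chi (int e)) * of_nat e powr (2 * s - 1) * of_nat M powr s * A q M =
          moebius_mu e * cnj (chi (int e)) * of_nat e powr (2 * s - 1) * of_nat M powr s *
          (\<psi> (int q) * \<psi> (int M) * At M q)"
        using dual_row by simp
    qed
    then have P: "Lt (1 - s) * hecke_polynomial A chi q m s = G.dual_sum q m s"
      using G.dual_hecke_polynomial[OF \<open>q > 0\<close> \<open>coprime q N\<close> \<open>m > 0\<close> \<open>coprime m N\<close> s2 Lt_sum[OF s4]]
      by simp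
    have N: "chi (- int N) = chi (- 1) * chi (int N)"
      using dirichlet_character_mult[OF chi, of "- 1" "int N"] by simp
    \<comment> \<open>The factor \<open>k\<close> from the product of the two Gauss sums shifts the
      exponent \<open>-3 * s\<close> to \<open>1 - 3 * s\<close>.\<close>
    have K: "of_nat k * of_nat k powr (- 3 * s) = (of_nat k powr (1 - 3 * s) :: complex)"
      using kpos by (simp add: powr_diff powr_minus divide_inverse)
    have "s \<in> by_parity chi Dp Dm" using dom[OF s0] by (simp add: by_parity_def)
    \<comment> \<open>Of the three Gauss sums in the functional equation, one pairs with the
      conjugate Gauss sum in \<open>Hc\<close>; the other two match the square in the bold
      G.\<close>
    then have "Hc s = (gauss_sum k chi * gauss_sum k (conj_char chi)) * by_parity chi Gp Gm s * \<psi> (int k) *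
        chi (int N) * of_nat k powr (- 3 * s) * gauss_sum k chi ^ 2 * (Lt (1 - s) * hecke_polynomial A chi q m s)"
      unfolding Hc_def by (simp add: FE power3_eq_cube power2_eq_square mult_ac)
    also have "\<dots> = chi (- int N) * \<psi> (int k) * by_parity chi Gp Gm s *
        (of_nat k * of_nat k powr (- 3 * s)) * gauss_sum k chi ^ 2 * G.dual_sum q m s"
      unfolding gauss_sum_mult_conj[OF prim] P N by (simp only: mult_ac)
    also have "\<dots> = bold_G N \<psi> Gp Gm At k chi q m s"
      unfolding K by (rule G.bold_G_eq[symmetric]) (fact \<open>q > 0\<close> \<open>coprime q N\<close> \<open>m > 0\<close> \<open>coprime m N\<close> s2)+
    finally show "Hc s = bold_G N \<psi> Gp Gm At k chi q m s" .
  qed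

  show ?thesis using hol Hc_H Hc_G by (intro exI[of _ Hc] conjI) blast+
qed

end
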